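(* Let $X$ be a visual, geodesic Gromov hyperbolic space, with its boundary at infinity $\partial_\infty X$ endowed with a visual metric. Then $$\operatorname{\ell-asdim}X=\operatorname{asdim}X=\operatorname{\ell-dim}(\partial_\infty X\times[0,1]).$$
   Context: Products of metric spaces carry the $l_\infty$-metric (maximum of the distances in the factors). Hyperbolicity. For $o,x,x'$ in a metric space $X$, the Gromov product is $(x|x')_o=\frac12(|xo|+|x'o|-|xx'|)$. $X$ is $\delta$-hyperbolic if $(x|y)_o\ge\min\{(x|z)_o,(z|y)_o\}-\delta$ for all $o,x,y,z\in X$; it is (Gromov) hyperbolic if it is $\delta$-hyperbolic for some $\delta\ge0$. $\partial_\infty X$ is the Gromov boundary at infinity; the Gromov product based at $o$ extends in the standard way to $\partial_\infty X$. A metric $d$ on $\partial_\infty X$ is visual if there are $o\in X$, $a>1$ and constants $c_1,c_2>0$ with $c_1a^{-(\xi|\xi')_o}\le d(\xi,\xi')\le c_2a^{-(\xi|\xi')_o}$ for all $\xi,\xi'\in\partial_\infty X$. A hyperbolic space $X$ is visual if for some base point $x_0\in X$ there is $D>0$ such that for every $x\in X$ there is $\xi\in\partial_\infty X$ with $|xx_0|\le(x|\xi)_{x_0}+D$. Coverings. For a family $\mathcal U$ of subsets of a metric space $Z$: $\operatorname{mesh}(\mathcal U)=\sup\{\operatorname{diam}U:U\in\mathcal U\}$; the multiplicity $m(\mathcal U)$ is the maximal number of members of $\mathcal U$ with nonempty intersection; $\mathcal U$ is disjoint if its members are pairwise disjoint; a covering is $m$-colored if it is the union of $m$ disjoint families.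 The Lebesgue number of an open covering $\mathcal U$ of $Z$ is $L(\mathcal U)=\inf_{z\in Z}\sup\{\operatorname{dist}(z,Z\setminus U):U\in\mathcal U\}$. An $(L,M,n)$-covering is an $n$-colored open covering $\mathcal U$ with $\operatorname{mesh}(\mathcal U)\le M$ and $L(\mathcal U)\ge L$. Dimensions. $\operatorname{\ell-dim}(Z)$ (linearly controlled dimension) is the minimal integer $m\ge0$ for which there is $\delta\in(0,1)$ such that for every sufficiently small $\tau>0$ there is an open $(\delta\tau,\tau,m+1)$-covering of $Z$. $\operatorname{asdim}X$ is the minimal integer $m\ge0$ such that for every $d>0$ there is an open covering $\mathcal U$ of $X$ with $m(\mathcal U)\le m+1$, $\operatorname{mesh}(\mathcal U)<\infty$ and $L(\mathcal U)\ge d$. $\operatorname{\ell-asdim}X$ (linearly controlled asymptotic dimension) is the minimal integer $n\ge0$ for which there is $C>1$ such that for every sufficiently large $d$ there is an open $(d,Cd,n+1)$-covering of $X$. Each is $\infty$ if no such integer exists. *)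

theory Defs
  imports "HOL-Analysis.Analysis" "HOL-Library.Disjoint_Sets"
begin

text \<open>A metric space is a carrier \<open>M\<close> with a distance function \<open>d\<close> satisfying
  \<^locale>\<open>Metric_space\<close>. The definitions below take \<open>M\<close> and \<open>d\<close> as plain
  arguments.\<close>

section \<open>Gromov hyperbolic spaces and their boundary at infinity\<close>

definition geodesic_metric :: "'a set \<Rightarrow> ('a \<Rightarrow> 'a \<Rightarrow> real) \<Rightarrow> bool" where
  "geodesic_metric M d \<longleftrightarrow>
     (\<forall>x\<in>M. \<forall>y\<in>M. \<exists>\<gamma>::real \<Rightarrow> 'a. \<gamma> ` {0..d x y} \<subseteq> M \<and> \<gamma> 0 = x \<and> \<gamma> (d x y) = y \<and>
        (\<forall>s\<in>{0..d x y}. \<forall>t\<in>{0..d x y}. d (\<gamma> s) (\<gamma> t) = \<bar>s - t\<bar>))"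

definition gromov_prod :: "('a \<Rightarrow> 'a \<Rightarrow> real) \<Rightarrow> 'a \<Rightarrow> 'a \<Rightarrow> 'a \<Rightarrow> real" where
  "gromov_prod d p x y = (d x p + d y p - d x y) / 2"

definition delta_hyperbolic :: "real \<Rightarrow> 'a set \<Rightarrow> ('a \<Rightarrow> 'a \<Rightarrow> real) \<Rightarrow> bool" where
  "delta_hyperbolic \<delta> M d \<longleftrightarrow>
     (\<forall>p\<in>M. \<forall>x\<in>M. \<forall>y\<in>M. \<forall>z\<in>M.
        gromov_prod d p x y \<ge> min (gromov_prod d p x z) (gromov_prod d p z y) - \<delta>)"

definition gromov_hyperbolic :: "'a set \<Rightarrow> ('a \<Rightarrow> 'a \<Rightarrow> real) \<Rightarrow> bool" where
  "gromov_hyperbolic M d \<longleftrightarrow> (\<exists>\<delta>\<ge>0. delta_hyperbolic \<delta> M d)"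

text \<open>Changing the base point changes a Gromov product by at most the distance of the two base
  points, so in the next two definitions quantifying over all base points \<open>p\<close> is the same as
  fixing one of them.\<close>

definition converges_to_infinity :: "'a set \<Rightarrow> ('a \<Rightarrow> 'a \<Rightarrow> real) \<Rightarrow> (nat \<Rightarrow> 'a) \<Rightarrow> bool" where
  "converges_to_infinity M d x \<longleftrightarrow>
     range x \<subseteq> M \<and>
     (\<forall>p\<in>M. filterlim (\<lambda>(i, j). gromov_prod d p (x i) (x j)) at_top (sequentially \<times>\<^sub>F sequentially))"

definition seq_equiv_at_infinity ::
    "'a set \<Rightarrow> ('a \<Rightarrow> 'a \<Rightarrow> real) \<Rightarrow> ((nat \<Rightarrow> 'a) \<times> (nat \<Rightarrow> 'a)) set" where
  "seq_equiv_at_infinity M d =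
     {(x, y). converges_to_infinity M d x \<and> converges_to_infinity M d y \<and>
        (\<forall>p\<in>M. filterlim (\<lambda>i. gromov_prod d p (x i) (y i)) at_top sequentially)}"

definition gromov_boundary :: "'a set \<Rightarrow> ('a \<Rightarrow> 'a \<Rightarrow> real) \<Rightarrow> (nat \<Rightarrow> 'a) set set" where
  "gromov_boundary M d = {x. converges_to_infinity M d x} // seq_equiv_at_infinity M d"

text \<open>The standard extensions of the Gromov product to points at infinity; the value is \<open>\<infinity>\<close>
  for two equal boundary points.\<close>

definition gromov_prod_bd_bd ::
    "('a \<Rightarrow> 'a \<Rightarrow> real) \<Rightarrow> 'a \<Rightarrow> (nat \<Rightarrow> 'a) set \<Rightarrow> (nat \<Rightarrow> 'a) set \<Rightarrow> ereal" where
  "gromov_prod_bd_bd d p \<xi> \<eta> =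
     (INF x\<in>\<xi>. INF y\<in>\<eta>. liminf (\<lambda>i. ereal (gromov_prod d p (x i) (y i))))"

definition gromov_prod_pt_bd ::
    "('a \<Rightarrow> 'a \<Rightarrow> real) \<Rightarrow> 'a \<Rightarrow> 'a \<Rightarrow> (nat \<Rightarrow> 'a) set \<Rightarrow> ereal" where
  "gromov_prod_pt_bd d p x \<xi> = (INF y\<in>\<xi>. liminf (\<lambda>i. ereal (gromov_prod d p x (y i))))"

definition visual_space :: "'a set \<Rightarrow> ('a \<Rightarrow> 'a \<Rightarrow> real) \<Rightarrow> bool" where
  "visual_space M d \<longleftrightarrow>
     (\<exists>x0\<in>M. \<exists>D>0. \<forall>x\<in>M. \<exists>\<xi>\<in>gromov_boundary M d.
        ereal (d x x0) \<le> gromov_prod_pt_bd d x0 x \<xi> + ereal D)"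

text \<open>\<open>a\<^sup>-\<^sup>t\<close> for \<open>0 \<le> t \<le> \<infinity>\<close> and \<open>a > 1\<close>; extended Gromov products are never negative.\<close>

definition neg_powr :: "real \<Rightarrow> ereal \<Rightarrow> real" where
  "neg_powr a t = (if t = \<infinity> then 0 else a powr (- real_of_ereal t))"

definition visual_metric ::
    "'a set \<Rightarrow> ('a \<Rightarrow> 'a \<Rightarrow> real) \<Rightarrow> ((nat \<Rightarrow> 'a) set \<Rightarrow> (nat \<Rightarrow> 'a) set \<Rightarrow> real) \<Rightarrow> bool" where
  "visual_metric M d \<rho> \<longleftrightarrow>
     Metric_space (gromov_boundary M d) \<rho> \<and>
     (\<exists>p\<in>M. \<exists>a>1. \<exists>c1>0. \<exists>c2>0. \<forall>\<xi>\<in>gromov_boundary M d. \<forall>\<eta>\<in>gromov_boundary M d.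
        c1 * neg_powr a (gromov_prod_bd_bd d p \<xi> \<eta>) \<le> \<rho> \<xi> \<eta> \<and>
        \<rho> \<xi> \<eta> \<le> c2 * neg_powr a (gromov_prod_bd_bd d p \<xi> \<eta>))"

section \<open>Coverings\<close>

definition linf_dist ::
    "('a \<Rightarrow> 'a \<Rightarrow> real) \<Rightarrow> ('b \<Rightarrow> 'b \<Rightarrow> real) \<Rightarrow> 'a \<times> 'b \<Rightarrow> 'a \<times> 'b \<Rightarrow> real" where
  "linf_dist d1 d2 u v = max (d1 (fst u) (fst v)) (d2 (snd u) (snd v))"

definition ediam :: "('a \<Rightarrow> 'a \<Rightarrow> real) \<Rightarrow> 'a set \<Rightarrow> ennreal" where
  "ediam d U = (SUP x\<in>U. SUP y\<in>U. ennreal (d x y))"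

definition mesh :: "('a \<Rightarrow> 'a \<Rightarrow> real) \<Rightarrow> 'a set set \<Rightarrow> ennreal" where
  "mesh d \<U> = (SUP U\<in>\<U>. ediam d U)"

text \<open>The distance to the empty set is \<open>\<infinity>\<close>.\<close>

definition edist_set :: "('a \<Rightarrow> 'a \<Rightarrow> real) \<Rightarrow> 'a \<Rightarrow> 'a set \<Rightarrow> ennreal" where
  "edist_set d z A = (INF y\<in>A. ennreal (d z y))"

definition lebesgue_number :: "'a set \<Rightarrow> ('a \<Rightarrow> 'a \<Rightarrow> real) \<Rightarrow> 'a set set \<Rightarrow> ennreal" where
  "lebesgue_number M d \<U> = (INF z\<in>M. SUP U\<in>\<U>. edist_set d z (M - U))"

definition cover_multiplicity :: "'a set set \<Rightarrow> enat" where
  "cover_multiplicity \<U> = (SUP F\<in>{F. F \<subseteq> \<U> \<and> finite F \<and> \<Inter>F \<noteq> {}}. enat (card F))"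

definition open_covering :: "'a set \<Rightarrow> ('a \<Rightarrow> 'a \<Rightarrow> real) \<Rightarrow> 'a set set \<Rightarrow> bool" where
  "open_covering M d \<U> \<longleftrightarrow> (\<forall>U\<in>\<U>. openin (Metric_space.mtopology M d) U) \<and> \<Union>\<U> = M"

definition colored :: "nat \<Rightarrow> 'a set set \<Rightarrow> bool" where
  "colored m \<U> \<longleftrightarrow> (\<exists>\<F>::nat \<Rightarrow> 'a set set. (\<forall>i<m. disjoint (\<F> i)) \<and> \<U> = (\<Union>i<m. \<F> i))"

definition LMn_covering ::
    "'a set \<Rightarrow> ('a \<Rightarrow> 'a \<Rightarrow> real) \<Rightarrow> real \<Rightarrow> real \<Rightarrow> nat \<Rightarrow> 'a set set \<Rightarrow> bool" where
  "LMn_covering M d L K n \<U> \<longleftrightarrow>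
     open_covering M d \<U> \<and> colored n \<U> \<and> mesh d \<U> \<le> ennreal K \<and>
     lebesgue_number M d \<U> \<ge> ennreal L"

section \<open>Dimensions\<close>

text \<open>In \<^typ>\<open>enat\<close> the infimum of a nonempty set is its minimum, and that of the empty set
  is \<open>\<infinity>\<close>.\<close>

definition l_dim :: "'a set \<Rightarrow> ('a \<Rightarrow> 'a \<Rightarrow> real) \<Rightarrow> enat" where
  "l_dim M d = Inf {enat m | m. \<exists>\<delta>\<in>{0<..<1}.
     eventually (\<lambda>\<tau>. \<exists>\<U>. LMn_covering M d (\<delta> * \<tau>) \<tau> (m + 1) \<U>) (at_right 0)}"

definition asdim :: "'a set \<Rightarrow> ('a \<Rightarrow> 'a \<Rightarrow> real) \<Rightarrow> enat" where
  "asdim M d = Inf {enat m | m. \<forall>D::real>0. \<exists>\<U>. open_covering M d \<U> \<and>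
     cover_multiplicity \<U> \<le> enat (m + 1) \<and> mesh d \<U> < \<infinity> \<and>
     lebesgue_number M d \<U> \<ge> ennreal D}"

definition l_asdim :: "'a set \<Rightarrow> ('a \<Rightarrow> 'a \<Rightarrow> real) \<Rightarrow> enat" where
  "l_asdim M d = Inf {enat n | n. \<exists>C>1.
     eventually (\<lambda>D. \<exists>\<U>. LMn_covering M d D (C * D) (n + 1) \<U>) at_top}"

end

theory Submission
  imports Defs
begin

text \<open>Write \<open>Z = \<partial>X \<times> [0,1]\<close>. The proof establishes the cycle
  \<open>asdim X \<le> \<ell>-asdim X \<le> \<ell>-dim Z \<le> asdim X\<close>. Its first link holds in any metric space, since
  members of an \<open>n\<close>-colored family with a common point have different colors.

  All three dimensions are first put into one language. An \<open>n\<close>-colored covering with Lebesgue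
  number about \<open>r\<close> and mesh about \<open>K\<close> is the same, up to constant factors, as a function \<open>c\<close> to
  \<open>{0..<n}\<close> such that every chain of constant color with steps shorter than \<open>r\<close> has endpoints at
  distance at most \<open>K\<close> (\<open>chain_colorable\<close>). Such colorings pull back along arbitrary maps that
  send short steps to short steps, continuous or not, and this is the reason for using them.

  A visual hyperbolic space with a visual metric on its boundary behaves like a cone over
  \<open>\<partial>X\<close>: a point \<open>x\<close> has a height \<open>|xp|\<close> and a shadow \<open>\<xi>\<close> on the boundary, and \<open>a\<^sup>-\<^sup>(\<^sup>x\<^sup>|\<^sup>y\<^sup>)\<close> is
  comparable to the largest of \<open>a\<^sup>-\<^sup>|\<^sup>x\<^sup>p\<^sup>|\<close>, \<open>a\<^sup>-\<^sup>|\<^sup>y\<^sup>p\<^sup>|\<close> and the distance of the shadows. The locale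
  \<open>boundary_shadow\<close> records this, and \<open>visual_boundary_shadow\<close> derives it from hyperbolicity.

  For \<open>\<ell>-dim Z \<le> asdim X\<close> (\<open>cylinder_chain_colorable\<close>), \<open>Z\<close> at a small scale \<open>\<tau>\<close> is mapped
  into a layer of \<open>X\<close> of fixed thickness whose outer height is \<open>-log \<tau>\<close>. The interval is
  much longer than the layer is thick, namely about \<open>1/\<tau>\<close> steps, so it is folded onto the
  layer by a triangular wave. A coloring of \<open>X\<close> with one fixed step size and bound \<open>K\<close> pulls back;
  since the layer is much thicker than \<open>K\<close>, a chain cannot reach both ends of it, hence
  stays within one period of the wave.

  For \<open>\<ell>-asdim X \<le> \<ell>-dim Z\<close> (\<open>space_chain_colorable\<close>), \<open>X\<close> is cut into slabs whose thickness
  \<open>s\<close> is a large multiple of the step size \<open>r\<close>. Slab \<open>k\<close> is colored through its map to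
  \<open>Z\<close> by the coloring of scale \<open>\<tau>\<^sub>k \<approx> a\<^sup>-\<^sup>k\<^sup>s\<close>. Two neighbouring slabs need no compatible
  colorings: a chain that enters slab \<open>k + 1\<close> from below stays near its bottom, and its displacement
  there, measured on the boundary, is of order \<open>\<tau>\<^sub>k\<^sub>+\<^sub>1\<close>, much less than \<open>\<tau>\<^sub>k\<close>; so
  if it returns, the excursion counts as a single step in slab \<open>k\<close>. A chain therefore meets at
  most two slabs.\<close>

section \<open>Chain colorings\<close>

definition linked :: "'a set \<Rightarrow> ('a \<Rightarrow> 'a \<Rightarrow> real) \<Rightarrow> ('a \<Rightarrow> nat) \<Rightarrow> real \<Rightarrow> 'a \<Rightarrow> 'a \<Rightarrow> bool" where
  "linked M d c r = (\<lambda>x y. x \<in> M \<and> y \<in> M \<and> c x = c y \<and> d x y < r)\<^sup>*\<^sup>*"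

text \<open>In words close to asymptotic dimension theory: the \<open>r\<close>-components of each color class are
  \<open>K\<close>-bounded.\<close>

definition chain_colorable ::
    "'a set \<Rightarrow> ('a \<Rightarrow> 'a \<Rightarrow> real) \<Rightarrow> nat \<Rightarrow> real \<Rightarrow> real \<Rightarrow> bool" where
  "chain_colorable M d n r K \<longleftrightarrow>
     (\<exists>c. (\<forall>x\<in>M. c x < n) \<and> (\<forall>x\<in>M. \<forall>y. linked M d c r x y \<longrightarrow> d x y \<le> K))"

text \<open>A Lebesgue number is a radius at which every point is deep in some member; stating this with
  balls avoids distances to a complement that may be empty.\<close>

definition deep :: "'a set \<Rightarrow> ('a \<Rightarrow> 'a \<Rightarrow> real) \<Rightarrow> 'a set \<Rightarrow> 'a \<Rightarrow> real \<Rightarrow> bool" where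
  "deep M d U z s \<longleftrightarrow> (\<forall>y\<in>M. d z y < s \<longrightarrow> y \<in> U)"

lemma linked_refl: "linked M d c r x x"
  by (simp add: linked_def)

lemma linked_step:
  "linked M d c r x y \<Longrightarrow> y \<in> M \<Longrightarrow> z \<in> M \<Longrightarrow> c y = c z \<Longrightarrow> d y z < r \<Longrightarrow> linked M d c r x z"
  unfolding linked_def by (rule rtranclp.rtrancl_into_rtrancl) auto

lemma linked_trans: "linked M d c r x y \<Longrightarrow> linked M d c r y z \<Longrightarrow> linked M d c r x z"
  unfolding linked_def by (rule rtranclp_trans)

lemma linked_induct [consumes 1, case_names base step]:
  assumes "linked M d c r x y" "P x"
    and "\<And>y z. linked M d c r x y \<Longrightarrow> P y \<Longrightarrow> y \<in> M \<Longrightarrow> z \<in> M \<Longrightarrow> c y = c z \<Longrightarrow> d y z < r \<Longrightarrow> P z"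
  shows "P y"
  using assms(1) unfolding linked_def
proof (induction rule: rtranclp_induct)
  case base then show ?case by (rule assms(2))
next
  case (step y z) then show ?case using assms(3)[of y z] by (auto simp: linked_def)
qed

lemma linked_in: "linked M d c r x y \<Longrightarrow> x \<in> M \<Longrightarrow> y \<in> M"
  by (induction rule: linked_induct) auto

lemma linked_color: "linked M d c r x y \<Longrightarrow> c y = c x"
  by (induction rule: linked_induct) auto

lemma linked_sym:
  assumes "Metric_space M d" "linked M d c r x y"
  shows "linked M d c r y x"
proof -
  interpret Metric_space M d by fact
  have "symp (\<lambda>x y. x \<in> M \<and> y \<in> M \<and> c x = c y \<and> d x y < r)"
    by (intro sympI conjI) (use commute in \<open>simp_all\<close>)
  from symp_rtranclp[OF this] show ?thesis
    using assms(2) unfolding linked_def by (rule sympD)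
qed

lemma chain_colorable_bounded:
  assumes "\<And>x y. x \<in> M \<Longrightarrow> y \<in> M \<Longrightarrow> d x y \<le> K" "0 < n"
  shows "chain_colorable M d n r K"
  unfolding chain_colorable_def
  using assms by (intro exI[of _ "\<lambda>_. 0"]) (auto intro: linked_in)

lemma chain_colorable_mono:
  "chain_colorable M d n r K \<Longrightarrow> K \<le> K' \<Longrightarrow> chain_colorable M d n r K'"
  unfolding chain_colorable_def by (meson order_trans)

lemma deep_iff_edist_set:
  assumes "Metric_space M d"
  shows "deep M d U z s \<longleftrightarrow> ennreal s \<le> edist_set d z (M - U)"
proof -
  interpret Metric_space M d by fact
  show ?thesis
    unfolding deep_def edist_set_def le_INF_iff by simp (meson DiffD1 DiffD2 DiffI not_le)
qed

lemma deep_below_lebesgue_number: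
  assumes "Metric_space M d" "ennreal L \<le> lebesgue_number M d \<U>" "0 \<le> s" "s < L" "z \<in> M"
  shows "\<exists>U\<in>\<U>. deep M d U z s"
proof -
  have "ennreal s < ennreal L" using assms by (simp add: ennreal_less_iff)
  also have "\<dots> \<le> (SUP U\<in>\<U>. edist_set d z (M - U))"
    using assms(2,5) unfolding lebesgue_number_def le_INF_iff by blast
  finally obtain U where "U \<in> \<U>" "ennreal s < edist_set d z (M - U)"
    unfolding less_SUP_iff by blast
  then show ?thesis using deep_iff_edist_set[OF assms(1)] less_imp_le by blast
qed

lemma lebesgue_number_geI:
  assumes "Metric_space M d" "\<And>z. z \<in> M \<Longrightarrow> \<exists>U\<in>\<U>. deep M d U z L"
  shows "ennreal L \<le> lebesgue_number M d \<U>"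
  unfolding lebesgue_number_def
proof (rule INF_greatest)
  fix z assume "z \<in> M"
  then obtain U where U: "U \<in> \<U>" "deep M d U z L" using assms(2) by blast
  then have "ennreal L \<le> edist_set d z (M - U)" using deep_iff_edist_set[OF assms(1)] by simp
  also have "\<dots> \<le> (SUP U\<in>\<U>. edist_set d z (M - U))" using U(1) by (rule SUP_upper)
  finally show "ennreal L \<le> (SUP U\<in>\<U>. edist_set d z (M - U))" .
qed

lemma mesh_le_iff:
  assumes "Metric_space M d" "0 \<le> K"
  shows "mesh d \<U> \<le> ennreal K \<longleftrightarrow> (\<forall>U\<in>\<U>. \<forall>x\<in>U. \<forall>y\<in>U. d x y \<le> K)"
  using assms(2) by (simp add: mesh_def ediam_def SUP_le_iff ennreal_le_iff)

section \<open>Coverings and chain colorings\<close>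

text \<open>Color a point by a family that has a member containing the \<open>r\<close>-ball about it. The next point
  of a chain then lies in that member, and as members of one family are disjoint, its own member is
  the same; so the chain never leaves the first member.\<close>

lemma LMn_covering_imp_chain_colorable:
  assumes "Metric_space M d" "LMn_covering M d L K n \<U>" "0 \<le> K" "0 < r" "r < L"
  shows "chain_colorable M d n r K"
proof -
  interpret Metric_space M d by fact
  from assms(2) obtain F where F: "\<And>i. i < n \<Longrightarrow> disjoint (F i)" "\<U> = (\<Union>i<n. F i)"
    unfolding LMn_covering_def colored_def by blast
  have m: "\<forall>U\<in>\<U>. \<forall>x\<in>U. \<forall>y\<in>U. d x y \<le> K"
    using assms(2) mesh_le_iff[OF assms(1,3)] unfolding LMn_covering_def by blast
  have "\<exists>i<n. \<exists>U\<in>F i. deep M d U z r" if "z \<in> M" for z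
    using deep_below_lebesgue_number[OF assms(1), of L \<U> r z] assms that F(2)
    unfolding LMn_covering_def by auto
  then obtain c U where c: "\<And>z. z \<in> M \<Longrightarrow> c z < n \<and> U z \<in> F (c z) \<and> deep M d (U z) z r"
    by metis
  have inU: "z \<in> U z" if "z \<in> M" for z
    using c[OF that] that assms(4) by (auto simp: deep_def)
  have "d x y \<le> K" if "x \<in> M" "linked M d c r x y" for x y
  proof -
    have "y \<in> U x \<and> c y = c x" using that(2)
    proof (induction rule: linked_induct)
      case base show ?case using inU that by simp
    next
      case (step y z)
      have "U y = U x"
        using F(1)[of "c x"] c[OF \<open>y \<in> M\<close>] c[OF \<open>x \<in> M\<close>] inU[OF \<open>y \<in> M\<close>] step.IH
        by (auto simp: disjoint_def)
      then show ?case using c[OF \<open>y \<in> M\<close>] step by (auto simp: deep_def)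
    qed
    moreover have "U x \<in> \<U>" using c[OF that(1)] F(2) by auto
    ultimately show ?thesis using m inU[OF that(1)] by blast
  qed
  then show ?thesis unfolding chain_colorable_def using c by blast
qed

text \<open>The members of color \<open>i\<close> are the open \<open>r/2\<close>-neighbourhoods of the \<open>r\<close>-components of
  color \<open>i\<close>. Two of them that meet belong to components with points at distance less than \<open>r\<close>,
  that is, to the same component.\<close>

lemma chain_colorable_imp_LMn_covering:
  assumes "Metric_space M d" "chain_colorable M d n r K" "0 \<le> K" "0 < r"
  shows "\<exists>\<U>. LMn_covering M d (r / 2) (K + r) n \<U>"
proof -
  interpret Metric_space M d by fact
  obtain c where c: "\<And>x. x \<in> M \<Longrightarrow> c x < n"
    and K: "\<And>x y. x \<in> M \<Longrightarrow> linked M d c r x y \<Longrightarrow> d x y \<le> K"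
    using assms(2) unfolding chain_colorable_def by blast
  define N where "N x = (\<Union>w\<in>{w. linked M d c r x w}. mball w (r / 2))" for x
  define F where "F i = N ` {x \<in> M. c x = i}" for i
  define \<U> where "\<U> = (\<Union>i<n. F i)"
  have N_iff: "y \<in> N x \<longleftrightarrow> (\<exists>w\<in>M. linked M d c r x w \<and> y \<in> M \<and> d w y < r / 2)" for x y
    unfolding N_def by auto
  have dj: "disjoint (F i)" for i
  proof -
    have "N x = N x'" if x: "x \<in> M" "x' \<in> M" "c x = i" "c x' = i" and y: "y \<in> N x" "y \<in> N x'" for x x' y
    proof -
      obtain w w' where w: "w \<in> M" "linked M d c r x w" "d w y < r/2"
         "w' \<in> M" "linked M d c r x' w'" "d w' y < r/2" "y \<in> M"
        using y N_iff by metis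
      have "d w w' < r" using triangle[of w y w'] w commute[of y w'] by linarith
      moreover have "c w = c w'" using linked_color[OF w(2)] linked_color[OF w(5)] x by simp
      ultimately have "linked M d c r x w'" using linked_step[OF w(2) w(1) w(4)] by blast
      then have xx': "linked M d c r x x'" by (rule linked_trans[OF _ linked_sym[OF assms(1) w(5)]])
      have "linked M d c r x = linked M d c r x'"
        using linked_trans[OF xx'] linked_trans[OF linked_sym[OF assms(1) xx']]
        by (intro ext iffI) auto
      then show ?thesis unfolding N_def by simp
    qed
    then show ?thesis by (intro disjointI) (clarsimp simp: F_def, metis disjoint_iff)
  qed
  have dp: "deep M d (N z) z (r/2)" if "z \<in> M" for z
    unfolding deep_def N_iff using that linked_refl[of M d c r z] by auto
  have "open_covering M d \<U>"
  proof -
    have "openin mtopology (N x)" for x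
      unfolding N_def by (rule openin_Union) (auto simp: openin_mball)
    moreover have "z \<in> N z" if "z \<in> M" for z
      using dp[OF that] assms(4) that unfolding deep_def by simp
    moreover have "N x \<subseteq> M" for x by (auto simp: N_def)
    ultimately show ?thesis
      unfolding open_covering_def \<U>_def F_def using c by (auto, metis lessThan_iff)
  qed
  moreover have "colored n \<U>" unfolding colored_def \<U>_def by (intro exI[of _ F] conjI allI impI dj refl)
  moreover have "mesh d \<U> \<le> ennreal (K + r)"
  proof -
    have "d y y' \<le> K + r" if x: "x \<in> M" and y: "y \<in> N x" "y' \<in> N x" for x y y'
    proof -
      obtain w w' where w: "w \<in> M" "linked M d c r x w" "d w y < r/2"
         "w' \<in> M" "linked M d c r x w'" "d w' y' < r/2" "y \<in> M" "y' \<in> M"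
        using y N_iff by metis
      have "d w w' \<le> K" using K[OF w(1)] linked_trans[OF linked_sym[OF assms(1) w(2)] w(5)] by blast
      then show ?thesis
        using triangle[of y w y'] triangle[of w w' y'] w commute[of y w] by linarith
    qed
    then show ?thesis
      using assms(3,4) by (subst mesh_le_iff[OF assms(1)]) (auto simp: \<U>_def F_def)
  qed
  moreover have "ennreal (r/2) \<le> lebesgue_number M d \<U>"
    by (rule lebesgue_number_geI[OF assms(1)]) (use dp c in \<open>auto simp: \<U>_def F_def\<close>)
  ultimately show ?thesis unfolding LMn_covering_def by blast
qed

lemma card_le_cover_multiplicity:
  assumes "cover_multiplicity \<U> \<le> enat m" "z \<in> M"
  shows "finite {U \<in> \<U>. z \<in> U}" "card {U \<in> \<U>. z \<in> U} \<le> m"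
proof -
  have le: "card G \<le> m" if "G \<subseteq> {U \<in> \<U>. z \<in> U}" "finite G" for G
  proof -
    have "G \<in> {G. G \<subseteq> \<U> \<and> finite G \<and> \<Inter>G \<noteq> {}}" using that by auto
    then have "enat (card G) \<le> cover_multiplicity \<U>"
      unfolding cover_multiplicity_def by (rule SUP_upper)
    then show ?thesis using assms(1) by (metis enat_ord_simps(1) order_trans)
  qed
  show fin: "finite {U \<in> \<U>. z \<in> U}"
  proof (rule ccontr)
    assume "infinite {U \<in> \<U>. z \<in> U}"
    from infinite_arbitrarily_large[OF this, of "Suc m"]
    obtain G where "finite G" "card G = Suc m" "G \<subseteq> {U \<in> \<U>. z \<in> U}" by blast
    then show False using le[of G] by simp
  qed
  show "card {U \<in> \<U>. z \<in> U} \<le> m" using le fin by blast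
qed

lemma antimono_pigeonhole:
  fixes f :: "nat \<Rightarrow> nat"
  assumes "\<And>i. i \<le> m \<Longrightarrow> f (Suc i) \<le> f i" "f 0 \<le> m" "1 \<le> f (Suc m)"
  shows "\<exists>i\<le>m. f (Suc i) = f i"
proof (rule ccontr)
  assume "\<not> ?thesis"
  then have lt: "f (Suc i) < f i" if "i \<le> m" for i using assms(1)[OF that] that by (meson le_neq_implies_less)
  have "f i + i \<le> m" if "i \<le> Suc m" for i using that
  proof (induction i)
    case (Suc i) then show ?case using lt[of i] by simp
  qed (use assms in simp)
  from this[of "Suc m"] show False by simp
qed

text \<open>A covering of multiplicity \<open>n\<close> yields \<open>n\<close> colors, not just a bounded number. Let \<open>S z j\<close> be
  the members in which \<open>z\<close> is deep at level \<open>(j + 1) r\<close>. These sets decrease with \<open>j\<close>, and there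
  are more levels than possible cardinalities, so the sets agree for two consecutive levels; the
  color of \<open>z\<close> is the cardinality of that stable set. A step shorter than \<open>r\<close> changes
  depth by less than one level, so the stable sets of its endpoints are comparable by inclusion; if
  the colors agree the sets are equal, and the whole chain stays in every member of the set.
  Comparing \<open>n\<close> cardinalities takes the \<open>n + 2\<close> levels up to \<open>(n + 2) r\<close>; the Lebesgue number has to
  exceed the last one strictly, as it need not be attained.\<close>

lemma multiplicity_imp_chain_colorable:
  assumes "Metric_space M d" "cover_multiplicity \<U> \<le> enat n"
    and "mesh d \<U> \<le> ennreal K" "0 \<le> K" "0 < r"
    and "ennreal (real (n + 3) * r) \<le> lebesgue_number M d \<U>"
  shows "chain_colorable M d n r K"
proof -
  interpret Metric_space M d by fact
  define S where "S z j = {U \<in> \<U>. deep M d U z (real (Suc j) * r)}" for z j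
  have S_anti: "S z j' \<subseteq> S z j" if "j \<le> j'" for z j j'
  proof -
    have "real (Suc j) * r \<le> real (Suc j') * r" using that assms(5) by (intro mult_right_mono) auto
    then show ?thesis unfolding S_def deep_def by force
  qed
  have S_sub: "S z j \<subseteq> {U \<in> \<U>. z \<in> U}" if "z \<in> M" for z j
    using that assms(5) by (auto simp: S_def deep_def)
  have S_fin: "finite (S z j)" if "z \<in> M" for z j
    using finite_subset[OF S_sub[OF that]] card_le_cover_multiplicity(1)[OF assms(2) that] by blast
  have shift: "S z (Suc j) \<subseteq> S w j" if "z \<in> M" "w \<in> M" "d z w < r" for z w j
  proof -
    have "d z y < real (Suc (Suc j)) * r" if "y \<in> M" "d w y < real (Suc j) * r" for y
      using triangle[OF \<open>z \<in> M\<close> \<open>w \<in> M\<close> \<open>y \<in> M\<close>] that \<open>d z w < r\<close> by (simp add: algebra_simps)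
    then show ?thesis unfolding S_def deep_def by blast
  qed
  have "\<exists>i. S z (Suc i) = S z i \<and> 1 \<le> card (S z i) \<and> card (S z i) \<le> n" if z: "z \<in> M" for z
  proof -
    have le: "card (S z i) \<le> n" for i
      using card_mono[OF card_le_cover_multiplicity(1)[OF assms(2) z] S_sub[OF z]]
        card_le_cover_multiplicity(2)[OF assms(2) z] order_trans by blast
    have "\<exists>U\<in>\<U>. deep M d U z (real (Suc (Suc n)) * r)"
      by (rule deep_below_lebesgue_number[OF assms(1,6)]) (use assms z in \<open>auto simp: algebra_simps\<close>)
    then have "S z (Suc n) \<noteq> {}" by (auto simp: S_def)
    then have pos: "1 \<le> card (S z (Suc n))" using S_fin[OF z] by (simp add: Suc_le_eq card_gt_0_iff)
    have "\<exists>i\<le>n. card (S z (Suc i)) = card (S z i)"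
      by (rule antimono_pigeonhole) (use le pos S_anti[OF le_SucI[OF order_refl]] S_fin[OF z] in \<open>auto intro!: card_mono\<close>)
    then obtain i where i: "i \<le> n" "card (S z (Suc i)) = card (S z i)" by blast
    have "S z (Suc i) = S z i"
      by (rule card_subset_eq) (use i S_anti S_fin[OF z] in auto)
    moreover have "card (S z (Suc n)) \<le> card (S z i)"
      by (rule card_mono) (use i S_anti[of i "Suc n" z] S_fin[OF z] in auto)
    ultimately show ?thesis using le[of i] pos by (intro exI[of _ i]) auto
  qed
  then obtain i where i: "\<And>z. z \<in> M \<Longrightarrow>
      S z (Suc (i z)) = S z (i z) \<and> 1 \<le> card (S z (i z)) \<and> card (S z (i z)) \<le> n"
    by metis
  define c where "c z = card (S z (i z)) - 1" for z
  have same: "S w (i w) \<subseteq> S z (i z)" if "z \<in> M" "w \<in> M" "d z w < r" "i z \<le> i w" for z w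
    using shift[of w z "i w"] that i[OF that(2)] S_anti[OF that(4)] commute[of z w] by auto
  have eq: "S w (i w) = S z (i z)" if "z \<in> M" "w \<in> M" "d z w < r" "c z = c w" for z w
  proof -
    have "card (S w (i w)) = card (S z (i z))"
      using that(4) i[OF that(1)] i[OF that(2)] unfolding c_def by linarith
    then show ?thesis
      using same[OF that(1-3)] same[OF that(2,1)] that commute[of z w] S_fin
      by (metis card_subset_eq nle_le)
  qed
  have "d x y \<le> K" if "x \<in> M" "linked M d c r x y" for x y
  proof -
    have "S y (i y) = S x (i x)" using that(2)
      by (induction rule: linked_induct) (auto simp: eq)
    moreover have "S x (i x) \<noteq> {}" using i[OF that(1)] by force
    then obtain U where "U \<in> S x (i x)" by blast
    ultimately have "U \<in> \<U>" "x \<in> U" "y \<in> U"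
      using S_sub that linked_in[OF that(2,1)] by blast+
    then show ?thesis using assms(3) mesh_le_iff[OF assms(1,4)] by blast
  qed
  moreover have "c z < n" if "z \<in> M" for z using i[OF that] unfolding c_def by linarith
  ultimately show ?thesis unfolding chain_colorable_def by blast
qed

lemma colored_cover_multiplicity:
  assumes "colored n \<U>"
  shows "cover_multiplicity \<U> \<le> enat n"
  unfolding cover_multiplicity_def
proof (rule SUP_least)
  fix G assume "G \<in> {F. F \<subseteq> \<U> \<and> finite F \<and> \<Inter>F \<noteq> {}}"
  then obtain x where G: "G \<subseteq> \<U>" "finite G" "\<And>U. U \<in> G \<Longrightarrow> x \<in> U" by blast
  obtain F where F: "\<And>i. i < n \<Longrightarrow> disjoint (F i)" "\<U> = (\<Union>i<n. F i)"
    using assms unfolding colored_def by blast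
  have "\<exists>i<n. U \<in> F i" if "U \<in> G" for U using that G(1) F(2) by auto
  then obtain c where c: "\<And>U. U \<in> G \<Longrightarrow> c U < n \<and> U \<in> F (c U)" by metis
  have "inj_on c G"
  proof (rule inj_onI)
    fix U V assume UV: "U \<in> G" "V \<in> G" "c U = c V"
    then have "U \<in> F (c U)" "V \<in> F (c U)" "disjoint (F (c U))"
      using c[OF UV(1)] c[OF UV(2)] F(1) by auto
    then show "U = V" using G(3)[OF UV(1)] G(3)[OF UV(2)] by (auto simp: disjoint_def)
  qed
  then have "card G \<le> card {..<n}" using c by (intro card_inj_on_le) auto
  then show "enat (card G) \<le> enat n" by simp
qed

section \<open>Spaces with shadows on a boundary\<close>

lemma dist_le_if_gromov_prod_ge: "- gromov_prod d p x y \<le> t \<Longrightarrow> d x y \<le> d x p + d y p + 2 * t"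
  by (simp add: gromov_prod_def field_simps)

lemma two_slab_heights:
  fixes t t' m s r :: real
  assumes "t < m + s" "t' < m + 2 * s" "0 < s"
  shows "t + t' + 2 * (2 * r - m) \<le> 4 * s + 4 * r"
  using assms by argo

text \<open>Hyperbolic geometry in the form of a cone: think of \<open>shadow x \<xi>\<close> as saying that \<open>x\<close> lies at
  bounded distance from a geodesic from \<open>p\<close> to \<open>\<xi>\<close>. The two inequalities say that \<open>a\<^sup>-\<^sup>(\<^sup>x\<^sup>|\<^sup>y\<^sup>)\<close> agrees,
  up to a factor, with the maximum of \<open>a\<^sup>-\<^sup>|\<^sup>x\<^sup>p\<^sup>|\<close>, \<open>a\<^sup>-\<^sup>|\<^sup>y\<^sup>p\<^sup>|\<close> and \<open>\<rho> \<xi> \<eta>\<close>, the first two being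
  at most \<open>a\<^sup>-\<^sup>(\<^sup>x\<^sup>|\<^sup>y\<^sup>)\<close> in any metric space. The last two assumptions say that every
  point has a shadow and that every boundary point is the shadow of points of all heights.\<close>

locale boundary_shadow =
  X: Metric_space X d + E: Metric_space E \<rho>
  for X :: "'a set" and d :: "'a \<Rightarrow> 'a \<Rightarrow> real" and E :: "'b set" and \<rho> :: "'b \<Rightarrow> 'b \<Rightarrow> real" +
  fixes p :: 'a and a A :: real and shadow :: "'a \<Rightarrow> 'b \<Rightarrow> bool"
  assumes base: "p \<in> X" and a_gt_1: "1 < a" and A_ge_1: "1 \<le> A"
    and shadow_dist_le: "\<lbrakk>x \<in> X; y \<in> X; \<xi> \<in> E; \<eta> \<in> E; shadow x \<xi>; shadow y \<eta>\<rbrakk> \<Longrightarrow>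
      \<rho> \<xi> \<eta> \<le> A * a powr (- gromov_prod d p x y)"
    and le_shadow_dist: "\<lbrakk>x \<in> X; y \<in> X; \<xi> \<in> E; \<eta> \<in> E; shadow x \<xi>; shadow y \<eta>\<rbrakk> \<Longrightarrow>
      a powr (- gromov_prod d p x y)
        \<le> A * max (a powr (- d x p)) (max (a powr (- d y p)) (\<rho> \<xi> \<eta>))"
    and ex_shadow: "x \<in> X \<Longrightarrow> \<exists>\<xi>\<in>E. shadow x \<xi>"
    and ex_point_over: "\<lbrakk>\<xi> \<in> E; 0 \<le> t\<rbrakk> \<Longrightarrow> \<exists>x\<in>X. d x p = t \<and> shadow x \<xi>"
begin

abbreviation "cyl \<equiv> E \<times> {0..1::real}"
abbreviation "cyl_dist \<equiv> linf_dist \<rho> dist"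

lemma gromov_prod_ge:
  assumes "d x y \<le> r" "t \<le> d x p" "t \<le> d y p"
  shows "t - r / 2 \<le> gromov_prod d p x y"
  using assms by (simp add: gromov_prod_def field_simps)

text \<open>Every boundary point is a shadow of the base point, where all Gromov products vanish.\<close>

lemma shadow_dist_le_A:
  assumes "\<xi> \<in> E" "\<eta> \<in> E"
  shows "\<rho> \<xi> \<eta> \<le> A"
proof -
  obtain x y where xy: "x \<in> X" "d x p = 0" "shadow x \<xi>" "y \<in> X" "d y p = 0" "shadow y \<eta>"
    using ex_point_over[OF assms(1), of 0] ex_point_over[OF assms(2), of 0] by auto
  then have "x = y" using base by simp
  then have "gromov_prod d p x y = 0" using xy base by (simp add: gromov_prod_def)
  then show ?thesis using shadow_dist_le[OF xy(1,4) assms xy(3,6)] a_gt_1 by simp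
qed

section \<open>From the cylinder to the space\<close>

text \<open>Slab \<open>k\<close> consists of the points of height between \<open>k s\<close> and \<open>(k + 1) s\<close>. Its scale
  \<open>\<tau> k = A a\<^sup>r\<^sup>-\<^sup>k\<^sup>s\<close> exceeds, by the factor \<open>a\<^sup>r\<^sup>/\<^sup>2\<close>, the bound for the distance of the shadows of two
  points of height at least \<open>k s\<close> and mutual distance less than \<open>r\<close>; this leaves room to combine several such steps
  into one step of a chain in the cylinder. The map \<open>\<Phi> k\<close> to the cylinder scales heights so
  that \<open>2 r\<close> becomes \<open>\<tau> k\<close>; a colored chain inside a slab \<open>k \<ge> 1\<close> then changes height by at
  most \<open>2 C r\<close>, and \<open>s = (2 C + 2) r\<close> is chosen such that it cannot cross the slab.

  The chains are followed from a point of lowest slab, where the invariant \<open>I\<close> below holds: the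
  point reached is connected within slab \<open>k\<close>, or it is on an excursion into slab \<open>k + 1\<close> that left
  slab \<open>k\<close> from a connected point \<open>w\<close>.\<close>

lemma space_chain_colorable:
  assumes C: "1 \<le> C" and r: "0 < r" "4 * A * (2 * C + 2) \<le> a powr (r / 2)"
    and col: "\<And>\<tau>. 0 < \<tau> \<Longrightarrow> chain_colorable cyl cyl_dist n \<tau> (C * \<tau>)"
  shows "chain_colorable X d n r ((16 * C + 24) * r)"
proof -
  define s where "s = (2 * C + 2) * r"
  have s: "0 < s" "2 * r \<le> s" "r < s" using C r by (auto simp: s_def algebra_simps intro: add_pos_nonneg)
  define \<tau> where "\<tau> k = A * a powr (r - real k * s)" for k
  have \<tau>_pos: "0 < \<tau> k" for k using A_ge_1 a_gt_1 by (simp add: \<tau>_def)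
  have "\<forall>k. \<exists>c. (\<forall>z\<in>cyl. c z < n) \<and>
      (\<forall>u\<in>cyl. \<forall>v. linked cyl cyl_dist c (\<tau> k) u v \<longrightarrow> cyl_dist u v \<le> C * \<tau> k)"
    using col[OF \<tau>_pos] unfolding chain_colorable_def by simp
  then obtain c where c_lt: "\<And>k z. z \<in> cyl \<Longrightarrow> c k z < n"
    and c_bd: "\<And>k u v. u \<in> cyl \<Longrightarrow> linked cyl cyl_dist (c k) (\<tau> k) u v \<Longrightarrow> cyl_dist u v \<le> C * \<tau> k"
    by metis
  obtain sh where sh: "\<And>x. x \<in> X \<Longrightarrow> sh x \<in> E \<and> shadow x (sh x)" using ex_shadow by metis
  have shE: "sh x \<in> E" if "x \<in> X" for x using sh that by blast
  define lev where "lev x = nat \<lfloor>d x p / s\<rfloor>" for x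
  have lev: "real (lev x) * s \<le> d x p" "d x p < (real (lev x) + 1) * s" for x
  proof -
    have "real (lev x) = of_int \<lfloor>d x p / s\<rfloor>" using s by (simp add: lev_def)
    then have "real (lev x) \<le> d x p / s" "d x p / s < real (lev x) + 1" by linarith+
    then show "real (lev x) * s \<le> d x p" "d x p < (real (lev x) + 1) * s"
      using s(1) by (auto simp: field_simps)
  qed
  have lev_less: "lev x < k" if "d x p < real k * s" for x k
  proof -
    have "real (lev x) * s < real k * s" using lev(1)[of x] that by linarith
    then show ?thesis using s(1) by simp
  qed
  \<comment> \<open>The truncation matters only in slab \<open>0\<close>, whose scaled heights may exceed \<open>1\<close>; from slab \<open>1\<close> on
    it is inactive by \<open>\<tau>_small\<close>. Slab \<open>0\<close> is only ever a lowest slab, where heights are not measured.\<close>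
  define \<Phi> where "\<Phi> k x = (sh x, min 1 (\<tau> k * (d x p - real k * s) / (2 * r)))" for k x
  have \<Phi>_in: "\<Phi> k x \<in> cyl" if "x \<in> X" "real k * s \<le> d x p" for k x
    using that sh \<tau>_pos[of k] r(1) by (simp add: \<Phi>_def)
  define col where "col x = c (lev x) (\<Phi> (lev x) x)" for x
  define G where "G k x y = linked cyl cyl_dist (c k) (\<tau> k) (\<Phi> k x) (\<Phi> k y)" for k x y
  have big: "4 \<le> a powr (r / 2)" "4 * A * (C + 1) \<le> a powr r" "4 * C \<le> a powr s"
    "A * (A * (2 * C + 1)) \<le> a powr r"
  proof -
    let ?b = "a powr (r / 2)"
    have AC: "1 \<le> A * (2 * C + 2)" using A_ge_1 C mult_mono[of 1 A 1 "2 * C + 2"] by simp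
    then show b4: "4 \<le> ?b" using r(2) by simp
    have bb: "a powr r = ?b * ?b" using a_gt_1 by (simp add: powr_add[symmetric])
    have ble: "?b \<le> a powr r" using b4 unfolding bb by (simp add: mult_le_cancel_left1)
    have "4 * A * (C + 1) \<le> 4 * A * (2 * C + 2)" using A_ge_1 C by (intro mult_left_mono) auto
    then show "4 * A * (C + 1) \<le> a powr r" using r(2) ble by linarith
    moreover have "4 * C \<le> 4 * A * (C + 1)"
      using mult_mono[of 1 A C "C + 1"] A_ge_1 C by simp
    moreover have "a powr r \<le> a powr s" using s(3) a_gt_1 by (intro powr_mono) auto
    ultimately show "4 * C \<le> a powr s" by linarith
    have "0 \<le> A * C" using A_ge_1 C by simp
    then have "A * (2 * C + 1) \<le> ?b" "A \<le> ?b"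
      using r(2) A_ge_1 by (simp_all add: algebra_simps)
    then show "A * (A * (2 * C + 1)) \<le> a powr r"
      unfolding bb using A_ge_1 C by (intro mult_mono) auto
  qed
  have \<tau>_Suc: "C * \<tau> (Suc k) \<le> \<tau> k / 4" for k
  proof -
    have "\<tau> k = \<tau> (Suc k) * a powr s"
      using a_gt_1 by (simp add: \<tau>_def powr_add[symmetric] algebra_simps)
    then show ?thesis using mult_left_mono[OF big(3) less_imp_le[OF \<tau>_pos[of "Suc k"]]]
      by (simp add: mult_ac)
  qed
  have \<tau>_small: "\<tau> (Suc k) * (C + 1) \<le> 1" for k
  proof -
    have "r - real (Suc k) * s \<le> - r"
    proof -
      have "real (Suc k) * s = s + real k * s" "0 \<le> real k * s" using s(1) by (auto simp: algebra_simps)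
      then show ?thesis using s(2) by linarith
    qed
    then have "\<tau> (Suc k) \<le> A * a powr (- r)"
      unfolding \<tau>_def using A_ge_1 a_gt_1 by (intro mult_left_mono powr_mono) auto
    then have "\<tau> (Suc k) * (C + 1) \<le> A * a powr (- r) * (C + 1)" using C by (intro mult_right_mono) auto
    also have "\<dots> = A * (C + 1) / a powr r" by (simp add: powr_minus field_simps)
    also have "\<dots> \<le> 1"
    proof -
      have "0 \<le> A * (C + 1)" using A_ge_1 C by simp
      then have "A * (C + 1) \<le> a powr r" using big(2) by linarith
      then show ?thesis using a_gt_1 by simp
    qed
    finally show ?thesis .
  qed
  have near: "\<rho> (sh x) (sh y) \<le> \<tau> k / 4"
    if "x \<in> X" "y \<in> X" "d x y < r" "real k * s \<le> d x p" "real k * s \<le> d y p" for x y k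
  proof -
    have "\<rho> (sh x) (sh y) \<le> A * a powr (- gromov_prod d p x y)"
      using shadow_dist_le sh that by blast
    also have "\<dots> \<le> A * a powr (r / 2 - real k * s)"
      using gromov_prod_ge[OF less_imp_le[OF that(3)] that(4,5)] A_ge_1 a_gt_1 by (intro mult_left_mono powr_mono) auto
    also have "\<dots> \<le> \<tau> k / 4"
    proof -
      have "\<tau> k = A * a powr (r / 2 - real k * s) * a powr (r / 2)"
        using a_gt_1 by (simp add: \<tau>_def powr_add[symmetric])
      then show ?thesis
        using mult_left_mono[OF big(1), of "A * a powr (r / 2 - real k * s)"] A_ge_1 by simp
    qed
    finally show ?thesis .
  qed
  have height_diff: "\<bar>d x p - d y p\<bar> \<le> d x y" if "x \<in> X" "y \<in> X" for x y
    using X.triangle[OF that(1) that(2) base] X.triangle[OF that(2) that(1) base] X.commute[of x y]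
    by linarith
  \<comment> \<open>The step may be the shortcut for an excursion into the next slab, which only keeps shadows and
    heights close; hence these conditions in place of a bound on \<open>d x y\<close>.\<close>
  have G_step: "G k z y" if "G k z x" "x \<in> X" "y \<in> X" "lev x = k" "lev y = k" "col x = col y"
     "\<rho> (sh x) (sh y) < \<tau> k" "\<bar>d x p - d y p\<bar> < r" for k x y z
    unfolding G_def
  proof (rule linked_step)
    show "\<Phi> k x \<in> cyl" "\<Phi> k y \<in> cyl" using \<Phi>_in that lev(1) by metis+
    show "c k (\<Phi> k x) = c k (\<Phi> k y)" using that by (simp add: col_def)
    have "\<bar>snd (\<Phi> k x) - snd (\<Phi> k y)\<bar>
        \<le> \<bar>\<tau> k * (d x p - real k * s) / (2 * r) - \<tau> k * (d y p - real k * s) / (2 * r)\<bar>"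
      by (simp add: \<Phi>_def)
    also have "\<tau> k * (d x p - real k * s) / (2 * r) - \<tau> k * (d y p - real k * s) / (2 * r)
       = \<tau> k * ((d x p - d y p) / (2 * r))"
      using r(1) by (simp add: field_simps)
    also have "\<bar>\<dots>\<bar> = \<tau> k * (\<bar>d x p - d y p\<bar> / (2 * r))"
      using \<tau>_pos[of k] r(1) by (simp add: abs_mult)
    also have "\<dots> < \<tau> k * 1" using that(8) r(1) \<tau>_pos[of k] by (intro mult_strict_left_mono) auto
    finally show "cyl_dist (\<Phi> k x) (\<Phi> k y) < \<tau> k"
      using that(7) by (simp add: linf_dist_def \<Phi>_def dist_real_def)
  qed (use that in \<open>simp add: G_def\<close>)
  have G_shadow: "\<rho> (sh x) (sh y) \<le> C * \<tau> k" if "G k x y" "x \<in> X" "real k * s \<le> d x p" for k x y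
    using c_bd[OF \<Phi>_in[OF that(2,3)] that(1)[unfolded G_def]] by (simp add: linf_dist_def \<Phi>_def)
  have G_height: "\<bar>d x p - d y p\<bar> \<le> 2 * C * r"
    if "G (Suc k) x y" "x \<in> X" "lev x = Suc k" "lev y = Suc k" for k x y
  proof -
    let ?k = "Suc k"
    have le1: "\<tau> ?k * (d v p - real ?k * s) / (2 * r) \<le> 1" if "lev v = ?k" for v
    proof -
      have "\<tau> ?k * (d v p - real ?k * s) \<le> \<tau> ?k * s"
        using lev(2)[of v] that \<tau>_pos[of ?k] by (intro mult_left_mono) (auto simp: algebra_simps)
      also have "\<dots> = (\<tau> ?k * (C + 1)) * (2 * r)" by (simp add: s_def algebra_simps)
      also have "\<dots> \<le> 1 * (2 * r)" using \<tau>_small[of k] r(1) by (intro mult_right_mono) auto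
      finally show ?thesis using r(1) by simp
    qed
    have "real ?k * s \<le> d x p" using lev(1)[of x] that by simp
    then have "cyl_dist (\<Phi> ?k x) (\<Phi> ?k y) \<le> C * \<tau> ?k"
      using c_bd[OF \<Phi>_in[OF that(2)] that(1)[unfolded G_def]] by blast
    then have "\<bar>\<tau> ?k * (d x p - real ?k * s) / (2 * r) - \<tau> ?k * (d y p - real ?k * s) / (2 * r)\<bar>
        \<le> C * \<tau> ?k"
      using le1[OF that(3)] le1[OF that(4)] by (simp add: linf_dist_def \<Phi>_def dist_real_def min_absorb2)
    also have "\<tau> ?k * (d x p - real ?k * s) / (2 * r) - \<tau> ?k * (d y p - real ?k * s) / (2 * r)
       = \<tau> ?k * ((d x p - d y p) / (2 * r))"
      using r(1) by (simp add: field_simps)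
    also have "\<bar>\<dots>\<bar> = \<tau> ?k * (\<bar>d x p - d y p\<bar> / (2 * r))"
      using \<tau>_pos[of ?k] r(1) by (simp add: abs_mult)
    finally have "\<tau> ?k * (\<bar>d x p - d y p\<bar> / (2 * r)) \<le> \<tau> ?k * C" by (simp only: mult.commute)
    then have "\<bar>d x p - d y p\<bar> / (2 * r) \<le> C" using \<tau>_pos[of ?k] by (rule mult_left_le_imp_le)
    then show ?thesis using r(1) by (simp add: field_simps)
  qed
  have half: "d z y \<le> (8 * C + 12) * r"
    if z: "z \<in> X" and zy: "linked X d col r z y"
      and min: "\<And>v. linked X d col r z v \<Longrightarrow> lev z \<le> lev v" for z y
  proof -
    define k where "k = lev z"
    have kz: "real k * s \<le> d z p" using lev(1)[of z] by (simp add: k_def)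
    have ks: "real k * s \<le> real (Suc k) * s" using s by (simp add: algebra_simps)
    define I where "I y \<longleftrightarrow> y \<in> X \<and> col y = col z \<and>
      (lev y = k \<and> G k z y \<or> lev y = Suc k \<and>
        (\<exists>w u. w \<in> X \<and> lev w = k \<and> col w = col z \<and> G k z w \<and>
           u \<in> X \<and> lev u = Suc k \<and> d w u < r \<and> G (Suc k) u y))" for y
    have "I y" using zy
    proof (induction rule: linked_induct)
      case base
      show ?case using z by (simp add: I_def k_def G_def linked_refl)
    next
      case (step y y')
      have colz: "col y' = col z" using step by (simp add: I_def)
      have levy': "k \<le> lev y'" unfolding k_def
        by (rule min, rule linked_step[OF step.hyps(1)]) (use step in auto)
      have hd: "\<bar>d y p - d y' p\<bar> < r" using height_diff[of y y'] step by simp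
      have ky': "real k * s \<le> d y' p"
      proof -
        have "real k * s \<le> real (lev y') * s" using levy' s(1) by simp
        then show ?thesis using lev(1)[of y'] by linarith
      qed
      consider (low) "lev y = k" "G k z y"
        | (high) w u where "lev y = Suc k" "w \<in> X" "lev w = k" "col w = col z" "G k z w"
           "u \<in> X" "lev u = Suc k" "d w u < r" "G (Suc k) u y"
        using step.IH unfolding I_def by blast
      then show ?case
      proof cases
        case low
        have ky: "real k * s \<le> d y p" using lev(1)[of y] low by simp
        have "d y' p < real (k + 2) * s"
          using hd lev(2)[of y] low s by (simp add: algebra_simps)
        then have "lev y' < k + 2" by (rule lev_less)
        then consider "lev y' = k" | "lev y' = Suc k" using levy' by linarith
        then show ?thesis
        proof cases
          case 1
          have "\<rho> (sh y) (sh y') < \<tau> k"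
            using near[OF \<open>y \<in> X\<close> \<open>y' \<in> X\<close> \<open>d y y' < r\<close> ky ky'] \<tau>_pos[of k] by linarith
          then have "G k z y'" using G_step[OF low(2)] step 1 low hd by blast
          then show ?thesis using 1 colz step by (simp add: I_def)
        next
          case 2
          have "G (Suc k) y' y'" by (simp add: G_def linked_refl)
          then show ?thesis using 2 low colz step unfolding I_def by metis
        qed
      next
        case high
        have hu: "\<bar>d w p - d u p\<bar> < r" using height_diff[of w u] high by simp
        have huy: "\<bar>d u p - d y p\<bar> \<le> 2 * C * r" using G_height high by blast
        \<comment> \<open>The excursion started below height \<open>(k + 1) s + r\<close>, so it cannot get out at the top.\<close>
        have "d y' p < real (k + 2) * s"
        proof -
          have "d y' p < (real k + 1) * s + r + 2 * C * r + r"
            using hu huy hd lev(2)[of w] high(3) by simp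
          also have "\<dots> = real (k + 2) * s" by (simp add: s_def algebra_simps)
          finally show ?thesis .
        qed
        then have "lev y' < k + 2" by (rule lev_less)
        then consider "lev y' = k" | "lev y' = Suc k" using levy' by linarith
        then show ?thesis
        proof cases
          case 1
          \<comment> \<open>The excursion ends: replace it by one step from \<open>w\<close> to \<open>y'\<close>.\<close>
          have kw: "real k * s \<le> d w p" using lev(1)[of w] high by simp
          have Ku: "real (Suc k) * s \<le> d u p" using lev(1)[of u] high by simp
          have Ky: "real (Suc k) * s \<le> d y p" using lev(1)[of y] high by simp
          have "\<rho> (sh w) (sh u) \<le> \<tau> k / 4"
            by (rule near) (use high kw Ku ks in auto)
          moreover have "\<rho> (sh u) (sh y) \<le> \<tau> k / 4"
            using G_shadow[OF high(9) high(6) Ku] \<tau>_Suc[of k] by linarith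
          moreover have "\<rho> (sh y) (sh y') \<le> \<tau> k / 4"
            by (rule near) (use step Ky ky' ks in auto)
          moreover have "\<rho> (sh w) (sh y') \<le> \<rho> (sh w) (sh u) + \<rho> (sh u) (sh y) + \<rho> (sh y) (sh y')"
            using E.triangle[OF shE shE shE, OF \<open>w \<in> X\<close> \<open>u \<in> X\<close> \<open>y' \<in> X\<close>]
              E.triangle[OF shE shE shE, OF \<open>u \<in> X\<close> \<open>y \<in> X\<close> \<open>y' \<in> X\<close>] by linarith
          ultimately have \<rho>: "\<rho> (sh w) (sh y') < \<tau> k" using \<tau>_pos[of k] by linarith
          have "d w p < real (Suc k) * s" "d y' p < real (Suc k) * s"
            using lev(2)[of w] lev(2)[of y'] high 1 by (auto simp: add.commute)
          then have "\<bar>d w p - d y' p\<bar> < r" using hu hd Ku Ky by linarith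
          then have "G k z y'" using G_step[OF high(5) high(2) \<open>y' \<in> X\<close> high(3) 1 _ \<rho>] high colz by simp
          then show ?thesis using 1 colz step by (simp add: I_def)
        next
          case 2
          have Ku: "real (Suc k) * s \<le> d y p" "real (Suc k) * s \<le> d y' p"
            using lev(1)[of y] lev(1)[of y'] high 2 by auto
          have "\<rho> (sh y) (sh y') < \<tau> (Suc k)"
            using near[OF \<open>y \<in> X\<close> \<open>y' \<in> X\<close> \<open>d y y' < r\<close> Ku] \<tau>_pos[of "Suc k"] by linarith
          then have "G (Suc k) u y'"
            using G_step[OF high(9) \<open>y \<in> X\<close> \<open>y' \<in> X\<close> high(1) 2 \<open>col y = col y'\<close> _ hd] by blast
          then show ?thesis using 2 high colz step unfolding I_def by metis
        qed
      qed
    qed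
    then have y: "y \<in> X" and cases: "lev y = k \<and> G k z y \<or> lev y = Suc k \<and>
        (\<exists>w u. w \<in> X \<and> lev w = k \<and> G k z w \<and>
           u \<in> X \<and> lev u = Suc k \<and> d w u < r \<and> G (Suc k) u y)"
      unfolding I_def by blast+
    have C\<tau>: "\<tau> k \<le> C * \<tau> k" "0 < C * \<tau> k" using C \<tau>_pos[of k] by (auto simp: mult_le_cancel_right1)
    have split: "(2 * C + 1) * \<tau> k = 2 * (C * \<tau> k) + \<tau> k" by (simp add: algebra_simps)
    have \<rho>: "\<rho> (sh z) (sh y) \<le> (2 * C + 1) * \<tau> k"
      using cases
    proof
      assume "lev y = k \<and> G k z y"
      then have "\<rho> (sh z) (sh y) \<le> C * \<tau> k" using G_shadow[OF _ z kz] by blast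
      then show ?thesis using C\<tau> \<tau>_pos[of k] split by linarith
    next
      assume "lev y = Suc k \<and> (\<exists>w u. w \<in> X \<and> lev w = k \<and> G k z w \<and>
           u \<in> X \<and> lev u = Suc k \<and> d w u < r \<and> G (Suc k) u y)"
      then obtain w u where wu: "w \<in> X" "lev w = k" "G k z w" "u \<in> X" "lev u = Suc k" "d w u < r"
          "G (Suc k) u y" by blast
      have kw: "real k * s \<le> d w p" using lev(1)[of w] wu by simp
      have Ku: "real (Suc k) * s \<le> d u p" using lev(1)[of u] wu by simp
      have "\<rho> (sh z) (sh w) \<le> C * \<tau> k" using G_shadow[OF wu(3) z kz] .
      moreover have "\<rho> (sh w) (sh u) \<le> \<tau> k / 4"
        by (rule near) (use wu kw Ku ks in auto)
      moreover have "\<rho> (sh u) (sh y) \<le> \<tau> k / 4"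
        using G_shadow[OF wu(7) wu(4) Ku] \<tau>_Suc[of k] by linarith
      moreover have "\<rho> (sh z) (sh y) \<le> \<rho> (sh z) (sh w) + \<rho> (sh w) (sh u) + \<rho> (sh u) (sh y)"
        using E.triangle[OF shE shE shE, OF z wu(1) y] E.triangle[OF shE shE shE, OF wu(1) wu(4) y]
        by linarith
      ultimately show ?thesis using C\<tau> \<tau>_pos[of k] split by linarith
    qed
    have "lev y \<le> Suc k" "k \<le> lev y" using cases by auto
    then have levy: "real k * s \<le> real (lev y) * s" "real (lev y) * s \<le> real (Suc k) * s"
      using s(1) by auto
    have hy: "real k * s \<le> d y p" "d y p < (real k + 2) * s"
    proof -
      show "real k * s \<le> d y p" using levy(1) lev(1) by (rule order_trans)
      have "real (lev y) + 1 \<le> real k + 2" using \<open>lev y \<le> Suc k\<close> by linarith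
      then have "(real (lev y) + 1) * s \<le> (real k + 2) * s" using s(1) by (intro mult_right_mono) auto
      with lev(2) show "d y p < (real k + 2) * s" by (rule less_le_trans)
    qed
    have hz: "d z p < (real k + 1) * s" using lev(2)[of z] by (simp add: k_def)
    have low: "a powr (- t) \<le> (2 * C + 1) * \<tau> k" if "real k * s \<le> t" for t
    proof -
      have "a powr (- t) \<le> 1 * a powr (r - real k * s)"
        using that r a_gt_1 by (simp add: powr_mono)
      also have "\<dots> \<le> A * a powr (r - real k * s)" using A_ge_1 by (intro mult_right_mono) auto
      also have "\<dots> \<le> (2 * C + 1) * \<tau> k"
        using C \<tau>_pos[of k] by (simp add: \<tau>_def[symmetric] mult_le_cancel_right1)
      finally show ?thesis .
    qed
    have "a powr (- gromov_prod d p z y)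
        \<le> A * max (a powr (- d z p)) (max (a powr (- d y p)) (\<rho> (sh z) (sh y)))"
      using le_shadow_dist z y sh by blast
    also have "\<dots> \<le> A * ((2 * C + 1) * \<tau> k)"
      using low[OF kz] low[OF hy(1)] \<rho> A_ge_1 by (intro mult_left_mono) auto
    also have "\<dots> = A * (A * (2 * C + 1)) * a powr (r - real k * s)" by (simp add: \<tau>_def)
    also have "\<dots> \<le> a powr r * a powr (r - real k * s)" using big(4) by (intro mult_right_mono) auto
    also have "\<dots> = a powr (2 * r - real k * s)" by (simp add: powr_add[symmetric])
    finally have "- gromov_prod d p z y \<le> 2 * r - real k * s" using a_gt_1 by simp
    then have "d z y \<le> d z p + d y p + 2 * (2 * r - real k * s)" by (rule dist_le_if_gromov_prod_ge)
    also have "\<dots> \<le> 4 * s + 4 * r"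
    proof -
      have "d z p < real k * s + s" "d y p < real k * s + 2 * s"
        using hz hy(2) by (simp_all only: distrib_right mult_1)
      then show ?thesis using s(1) by (rule two_slab_heights)
    qed
    also have "\<dots> = (8 * C + 12) * r" by (simp add: s_def algebra_simps)
    finally show ?thesis .
  qed
  \<comment> \<open>Both endpoints are compared with a point of lowest slab in the chain component.\<close>
  have "d x y \<le> (16 * C + 24) * r" if x: "x \<in> X" and xy: "linked X d col r x y" for x y
  proof -
    obtain z where z: "linked X d col r x z"
      and min: "\<And>v. linked X d col r x v \<Longrightarrow> lev z \<le> lev v"
      using ex_has_least_nat[of "linked X d col r x" x lev] linked_refl[of X d col r x] by auto
    have zX: "z \<in> X" using linked_in[OF z x] .
    have zx: "linked X d col r z x" using linked_sym[OF X.Metric_space_axioms z] .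
    have min': "lev z \<le> lev v" if "linked X d col r z v" for v
      using min[OF linked_trans[OF z that]] .
    have "d z x \<le> (8 * C + 12) * r" using half[OF zX zx min'] .
    moreover have "d z y \<le> (8 * C + 12) * r" using half[OF zX linked_trans[OF zx xy] min'] .
    moreover have "d x y \<le> d z x + d z y"
      using X.triangle[OF x zX linked_in[OF xy x]] X.commute[of x z] by linarith
    ultimately show ?thesis by (simp add: algebra_simps)
  qed
  moreover have "col x < n" if "x \<in> X" for x
    using c_lt[OF \<Phi>_in[OF that lev(1)]] by (simp add: col_def)
  ultimately show ?thesis unfolding chain_colorable_def by blast
qed

end

section \<open>From the space to the cylinder\<close>

text \<open>The triangular wave of slope \<open>\<plusminus>1\<close> that vanishes at the even multiples of \<open>T\<close> and equals \<open>T\<close>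
  at the odd ones.\<close>

definition wave :: "real \<Rightarrow> real \<Rightarrow> real" where
  "wave T u = infdist u (range (\<lambda>m::int. 2 * T * of_int m))"

lemma wave_nonneg: "0 \<le> wave T u"
  by (simp add: wave_def infdist_nonneg)

lemma wave_le_dist: "wave T u \<le> \<bar>u - 2 * T * of_int m\<bar>"
  unfolding wave_def using infdist_le[of "2 * T * of_int m" "range (\<lambda>m::int. 2 * T * of_int m)" u,
      OF rangeI]
  by (simp add: dist_real_def)

lemma wave_le:
  assumes "0 < T"
  shows "wave T u \<le> T"
proof -
  have "\<bar>of_int (round (u / (2 * T))) - u / (2 * T)\<bar> \<le> 1 / 2" by (rule of_int_round_abs_le)
  then have "\<bar>of_int (round (u / (2 * T))) - u / (2 * T)\<bar> * (2 * T) \<le> 1 / 2 * (2 * T)"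
    using assms by (intro mult_right_mono) auto
  also have "\<bar>of_int (round (u / (2 * T))) - u / (2 * T)\<bar> * (2 * T)
      = \<bar>(of_int (round (u / (2 * T))) - u / (2 * T)) * (2 * T)\<bar>"
    using assms by (simp add: abs_mult)
  also have "(of_int (round (u / (2 * T))) - u / (2 * T)) * (2 * T)
      = 2 * T * of_int (round (u / (2 * T))) - u"
    using assms by (simp add: field_simps)
  finally show ?thesis using wave_le_dist[of T u "round (u / (2 * T))"] by linarith
qed

lemma wave_lipschitz: "\<bar>wave T u - wave T v\<bar> \<le> \<bar>u - v\<bar>"
  unfolding wave_def using infdist_triangle_abs[of u _ v] by (simp add: dist_real_def)

lemma wave_near_odd:
  assumes "0 < T"
  shows "T - \<bar>u - (2 * of_int m - 1) * T\<bar> \<le> wave T u"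
proof -
  have "T - \<bar>u - (2 * of_int m - 1) * T\<bar> \<le> dist u (2 * T * of_int j)" for j
  proof -
    have "1 \<le> \<bar>2 * m - 1 - 2 * j\<bar>" by presburger
    then have "1 \<le> \<bar>real_of_int (2 * m - 1 - 2 * j)\<bar>" by linarith
    then have "1 * T \<le> \<bar>real_of_int (2 * m - 1 - 2 * j)\<bar> * T" using assms by (intro mult_right_mono) auto
    also have "\<dots> = \<bar>real_of_int (2 * m - 1 - 2 * j) * T\<bar>" using assms by (simp add: abs_mult)
    also have "real_of_int (2 * m - 1 - 2 * j) * T = (2 * of_int m - 1) * T - 2 * T * of_int j"
      by (simp add: algebra_simps)
    finally show ?thesis unfolding dist_real_def by linarith
  qed
  then show ?thesis by (auto simp: wave_def infdist_notempty intro!: cINF_greatest)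
qed

lemma integer_between:
  fixes u v :: real
  assumes "\<lfloor>u\<rfloor> \<noteq> \<lfloor>v\<rfloor>"
  shows "\<exists>m::int. \<bar>u - of_int m\<bar> \<le> \<bar>u - v\<bar>"
proof (cases "\<lfloor>u\<rfloor> < \<lfloor>v\<rfloor>")
  case True
  then have "u < of_int \<lfloor>v\<rfloor>" "of_int \<lfloor>v\<rfloor> \<le> v" by linarith+
  then show ?thesis by (intro exI[of _ "\<lfloor>v\<rfloor>"]) linarith
next
  case False
  then have "v < of_int \<lfloor>u\<rfloor>" "of_int \<lfloor>u\<rfloor> \<le> u" using assms by linarith+
  then show ?thesis by (intro exI[of _ "\<lfloor>u\<rfloor>"]) linarith
qed

lemma multiple_between:
  fixes u v :: real
  assumes "0 < L" "\<lfloor>u / L\<rfloor> \<noteq> \<lfloor>v / L\<rfloor>"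
  shows "\<exists>m::int. \<bar>u - L * of_int m\<bar> \<le> \<bar>u - v\<bar>"
proof -
  obtain m :: int where "\<bar>u / L - of_int m\<bar> \<le> \<bar>u / L - v / L\<bar>"
    using integer_between[OF assms(2)] by blast
  then have "\<bar>u / L - of_int m\<bar> * L \<le> \<bar>u / L - v / L\<bar> * L" using assms(1) by (intro mult_right_mono) auto
  moreover have "\<bar>u / L - of_int m\<bar> * L = \<bar>(u / L - of_int m) * L\<bar>"
    "\<bar>u / L - v / L\<bar> * L = \<bar>(u / L - v / L) * L\<bar>"
    using assms(1) by (simp_all add: abs_mult)
  moreover have "(u / L - of_int m) * L = u - L * of_int m" "(u / L - v / L) * L = u - v"
    using assms(1) by (simp_all add: field_simps)
  ultimately show ?thesis by metis
qed

text \<open>A short step away from the minima stays between two consecutive even multiples of \<open>T\<close>; the next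
  lemma is the counterpart for steps away from the maxima.\<close>

lemma wave_even_cell:
  assumes "0 < T" "\<bar>u - v\<bar> \<le> 1" "1 < wave T u"
  shows "\<lfloor>u / (2 * T)\<rfloor> = \<lfloor>v / (2 * T)\<rfloor>"
proof (rule ccontr)
  assume "\<not> ?thesis"
  then obtain m :: int where "\<bar>u - 2 * T * of_int m\<bar> \<le> \<bar>u - v\<bar>"
    using multiple_between[of "2 * T" u v] assms(1) by auto
  then show False using wave_le_dist[of T u m] assms by linarith
qed

lemma wave_odd_cell:
  assumes "0 < T" "\<bar>u - v\<bar> \<le> 1" "wave T u < T - 1"
  shows "\<lfloor>(u + T) / (2 * T)\<rfloor> = \<lfloor>(v + T) / (2 * T)\<rfloor>"
proof (rule ccontr)
  assume "\<not> ?thesis"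
  then obtain m :: int where "\<bar>(u + T) - 2 * T * of_int m\<bar> \<le> \<bar>(u + T) - (v + T)\<bar>"
    using multiple_between[of "2 * T" "u + T" "v + T"] assms(1) by auto
  moreover have "(u + T) - 2 * T * of_int m = u - (2 * of_int m - 1) * T" by (simp add: algebra_simps)
  ultimately show False using wave_near_odd[OF assms(1), of u m] assms by simp
qed

lemma same_cell_dist:
  fixes u v :: real
  assumes "0 < L" "\<lfloor>u / L\<rfloor> = \<lfloor>v / L\<rfloor>"
  shows "\<bar>u - v\<bar> \<le> L"
proof -
  have "\<bar>u / L - v / L\<bar> \<le> 1" using assms(2) by linarith
  then show ?thesis using assms(1) by (simp add: diff_divide_distrib[symmetric])
qed

text \<open>The point \<open>(\<xi>, u)\<close> goes to a point over \<open>\<xi>\<close> of height \<open>R + wave T (u/\<tau>)\<close>, where the layer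
  between \<open>R\<close> and \<open>R + T\<close> is placed such that \<open>a\<^sup>-\<^sup>(\<^sup>R\<^sup>+\<^sup>T\<^sup>) = \<tau>\<close>. Points of the layer with shadows
  closer than \<open>\<tau>\<close> are then separated by little more than their difference of height, so
  steps shorter than \<open>\<tau>\<close> become steps of length bounded independently of \<open>\<tau>\<close>. The bound \<open>K\<close> for the
  resulting step size has to be known before \<open>T\<close> is chosen.\<close>

lemma (in boundary_shadow) cylinder_chain_colorable:
  assumes "\<And>r. 0 < r \<Longrightarrow> \<exists>K\<ge>0. chain_colorable X d n r K"
  shows "\<exists>C\<ge>1. \<exists>\<tau>0>0. \<forall>\<tau>. 0 < \<tau> \<and> \<tau> \<le> \<tau>0 \<longrightarrow> chain_colorable cyl cyl_dist n \<tau> (C * \<tau>)"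
proof -
  define q where "q = log a A"
  have q: "0 \<le> q" "a powr q = A" using a_gt_1 A_ge_1 by (auto simp: q_def)
  obtain K where K: "0 \<le> K" "chain_colorable X d n (2 * q + 2) K"
    using assms[of "2 * q + 2"] q by auto
  obtain c where c_lt: "\<And>x. x \<in> X \<Longrightarrow> c x < n"
    and c_bd: "\<And>x y. x \<in> X \<Longrightarrow> linked X d c (2 * q + 2) x y \<Longrightarrow> d x y \<le> K"
    using K(2) unfolding chain_colorable_def by metis
  define T where "T = 2 * K + 8"
  have T: "0 < T" using K by (simp add: T_def)
  obtain g where g: "\<And>\<xi> t. \<xi> \<in> E \<Longrightarrow> 0 \<le> t \<Longrightarrow> g \<xi> t \<in> X \<and> d (g \<xi> t) p = t \<and> shadow (g \<xi> t) \<xi>"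
    using ex_point_over by metis
  define C where "C = max (max 1 (2 * T)) (A * a powr (K / 2 + T))"
  have C: "1 \<le> C" "2 * T \<le> C" "A * a powr (K / 2 + T) \<le> C" by (auto simp: C_def)
  have "chain_colorable cyl cyl_dist n \<tau> (C * \<tau>)" if \<tau>: "0 < \<tau>" "\<tau> \<le> a powr (- T)" for \<tau>
  proof -
    define R where "R = - log a \<tau> - T"
    have "log a \<tau> \<le> - T" using \<tau> a_gt_1 by (simp add: log_le_iff)
    then have R: "0 \<le> R" by (simp add: R_def)
    have a\<tau>: "a powr (- (R + T)) = \<tau>" using \<tau> a_gt_1 by (simp add: R_def)
    define h where "h z = R + wave T (snd z / \<tau>)" for z :: "'b \<times> real"
    define \<Psi> where "\<Psi> z = g (fst z) (h z)" for z
    have h: "R \<le> h z" "h z \<le> R + T" for z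
      using wave_nonneg[of T "snd z / \<tau>"] wave_le[OF T, of "snd z / \<tau>"] by (auto simp: h_def)
    have \<Psi>: "\<Psi> z \<in> X" "d (\<Psi> z) p = h z" "shadow (\<Psi> z) (fst z)" "fst z \<in> E" if "z \<in> cyl" for z
      using g[of "fst z" "h z"] h(1)[of z] R that by (auto simp: \<Psi>_def)
    have step_h: "\<bar>snd u / \<tau> - snd v / \<tau>\<bar> \<le> 1" if "cyl_dist u v < \<tau>" for u v
      using that \<tau>(1)
      by (simp add: linf_dist_def dist_real_def diff_divide_distrib[symmetric] abs_divide)
    have step_d: "d (\<Psi> u) (\<Psi> v) < 2 * q + 2" if uv: "u \<in> cyl" "v \<in> cyl" "cyl_dist u v < \<tau>" for u v
    proof -
      have hh: "\<bar>h u - h v\<bar> \<le> 1"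
        using step_h[OF uv(3)] wave_lipschitz[of T "snd u / \<tau>" "snd v / \<tau>"] by (simp add: h_def)
      define m where "m = min (h u) (h v)"
      have "a powr (- (R + T)) \<le> a powr (- m)"
        using h(2)[of u] h(2)[of v] a_gt_1 by (intro powr_mono) (auto simp: m_def min_def)
      moreover have "\<rho> (fst u) (fst v) < \<tau>" using uv(3) by (simp add: linf_dist_def)
      ultimately have "\<rho> (fst u) (fst v) \<le> a powr (- m)" using a\<tau> by linarith
      moreover have "a powr (- h u) \<le> a powr (- m)" "a powr (- h v) \<le> a powr (- m)"
        using a_gt_1 by (auto intro!: powr_mono simp: m_def)
      ultimately have le: "max (a powr (- h u)) (max (a powr (- h v)) (\<rho> (fst u) (fst v))) \<le> a powr (- m)"
        by simp
      have "a powr (- gromov_prod d p (\<Psi> u) (\<Psi> v))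
          \<le> A * max (a powr (- h u)) (max (a powr (- h v)) (\<rho> (fst u) (fst v)))"
        using le_shadow_dist[OF \<Psi>(1)[OF uv(1)] \<Psi>(1)[OF uv(2)] \<Psi>(4)[OF uv(1)] \<Psi>(4)[OF uv(2)]]
          \<Psi>[OF uv(1)] \<Psi>[OF uv(2)] by simp
      also have "\<dots> \<le> A * a powr (- m)" using le A_ge_1 by (intro mult_left_mono) auto
      also have "\<dots> = a powr (q - m)" using q by (simp add: powr_add[symmetric] flip: q(2))
      finally have "m - q \<le> gromov_prod d p (\<Psi> u) (\<Psi> v)" using a_gt_1 by simp
      then have "d (\<Psi> u) (\<Psi> v) \<le> h u + h v - 2 * m + 2 * q"
        using \<Psi>(2) uv by (simp add: gromov_prod_def)
      then show ?thesis using hh unfolding m_def by linarith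
    qed
    have lk: "linked X d c (2 * q + 2) (\<Psi> u) (\<Psi> v)" if "linked cyl cyl_dist (c \<circ> \<Psi>) \<tau> u v" for u v
      using that
    proof (induction rule: linked_induct)
      case (step v w)
      then show ?case using linked_step[OF step.IH] \<Psi>(1) step_d by simp
    qed (simp add: linked_refl)
    have "cyl_dist u v \<le> C * \<tau>" if u: "u \<in> cyl" and uv: "linked cyl cyl_dist (c \<circ> \<Psi>) \<tau> u v" for u v
    proof -
      have v: "v \<in> cyl" using linked_in[OF uv u] .
      have dK: "d (\<Psi> u) (\<Psi> w) \<le> K" if "linked cyl cyl_dist (c \<circ> \<Psi>) \<tau> u w" for w
        using c_bd[OF \<Psi>(1)[OF u] lk[OF that]] .
      have hK: "\<bar>h u - h w\<bar> \<le> K" if "linked cyl cyl_dist (c \<circ> \<Psi>) \<tau> u w" for w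
      proof -
        have w: "w \<in> cyl" using linked_in[OF that u] .
        show ?thesis
          using dK[OF that] X.triangle[OF \<Psi>(1)[OF u] \<Psi>(1)[OF w] base]
            X.triangle[OF \<Psi>(1)[OF w] \<Psi>(1)[OF u] base] X.commute[of "\<Psi> w" "\<Psi> u"] \<Psi>(2)[OF u] \<Psi>(2)[OF w]
          by linarith
      qed
      have "\<rho> (fst u) (fst v) \<le> A * a powr (- gromov_prod d p (\<Psi> u) (\<Psi> v))"
        by (rule shadow_dist_le) (use \<Psi>[OF u] \<Psi>[OF v] in auto)
      also have "\<dots> \<le> A * a powr (K / 2 - R)"
        using gromov_prod_ge[OF dK[OF uv], of R] h(1) \<Psi>(2)[OF u] \<Psi>(2)[OF v] A_ge_1 a_gt_1
        by (intro mult_left_mono powr_mono) auto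
      also have "\<dots> = A * a powr (K / 2 + T) * a powr (- (R + T))"
        by (simp add: powr_add[symmetric])
      also have "\<dots> \<le> C * \<tau>" unfolding a\<tau> using C(3) \<tau>(1) by (intro mult_right_mono) auto
      finally have \<rho>: "\<rho> (fst u) (fst v) \<le> C * \<tau>" .
      \<comment> \<open>Along the chain the wave varies by at most \<open>K < T/2 - 1\<close>, so it avoids its minima or its
        maxima, whichever is farther away at the start.\<close>
      have "\<bar>snd u / \<tau> - snd v / \<tau>\<bar> \<le> 2 * T"
      proof (cases "T / 2 \<le> wave T (snd u / \<tau>)")
        case True
        have "\<lfloor>snd u / \<tau> / (2 * T)\<rfloor> = \<lfloor>snd v / \<tau> / (2 * T)\<rfloor>" using uv
        proof (induction rule: linked_induct)
          case (step v w)
          have "1 < wave T (snd v / \<tau>)"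
            using hK[OF step.hyps(1)] True by (simp add: h_def T_def)
          then show ?case using wave_even_cell[OF T step_h[OF step.hyps(5)]] step.IH by simp
        qed simp
        then show ?thesis by (rule same_cell_dist[rotated]) (use T in simp)
      next
        case False
        have "\<lfloor>(snd u / \<tau> + T) / (2 * T)\<rfloor> = \<lfloor>(snd v / \<tau> + T) / (2 * T)\<rfloor>" using uv
        proof (induction rule: linked_induct)
          case (step v w)
          have "wave T (snd v / \<tau>) < T - 1"
            using hK[OF step.hyps(1)] False by (simp add: h_def T_def)
          then show ?case using wave_odd_cell[OF T step_h[OF step.hyps(5)]] step.IH by simp
        qed simp
        then have "\<bar>(snd u / \<tau> + T) - (snd v / \<tau> + T)\<bar> \<le> 2 * T"
          by (rule same_cell_dist[rotated]) (use T in simp)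
        then show ?thesis by simp
      qed
      then have "\<bar>snd u - snd v\<bar> \<le> 2 * T * \<tau>"
        using \<tau>(1) by (simp add: diff_divide_distrib[symmetric] abs_divide divide_le_eq)
      also have "\<dots> \<le> C * \<tau>" using C(2) \<tau>(1) by (intro mult_right_mono) auto
      finally show ?thesis using \<rho> by (simp add: linf_dist_def dist_real_def)
    qed
    moreover have "(c \<circ> \<Psi>) z < n" if "z \<in> cyl" for z using c_lt \<Psi>(1)[OF that] by simp
    ultimately show ?thesis unfolding chain_colorable_def by blast
  qed
  then show ?thesis using C(1) a_gt_1
    by (intro exI[of _ C] conjI exI[of _ "a powr (- T)"]) auto
qed

section \<open>Shadows in visual hyperbolic spaces\<close>

lemma gromov_prod_nonneg:
  assumes "Metric_space M d" "p \<in> M" "x \<in> M" "y \<in> M"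
  shows "0 \<le> gromov_prod d p x y"
proof -
  interpret Metric_space M d by fact
  show ?thesis using triangle[of x p y] commute[of p y] assms by (simp add: gromov_prod_def)
qed

lemma gromov_prod_commute: "Metric_space M d \<Longrightarrow> gromov_prod d p x y = gromov_prod d p y x"
  by (simp add: gromov_prod_def Metric_space.commute)

lemma gromov_prod_le_dist:
  assumes "Metric_space M d" "p \<in> M" "x \<in> M" "y \<in> M"
  shows "gromov_prod d p x y \<le> d x p"
proof -
  interpret Metric_space M d by fact
  show ?thesis using triangle[of y x p] commute[of x y] assms by (simp add: gromov_prod_def)
qed

lemma delta_hyperbolic_three:
  assumes "delta_hyperbolic \<delta> M d" "0 \<le> \<delta>" "p \<in> M" "x \<in> M" "u \<in> M" "v \<in> M" "y \<in> M"
    and "s \<le> gromov_prod d p x u" "t \<le> gromov_prod d p u v" "s' \<le> gromov_prod d p v y"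
  shows "min s (min t s') - 2 * \<delta> \<le> gromov_prod d p x y"
proof -
  have "min (gromov_prod d p x u) (gromov_prod d p u y) - \<delta> \<le> gromov_prod d p x y"
    "min (gromov_prod d p u v) (gromov_prod d p v y) - \<delta> \<le> gromov_prod d p u y"
    using assms(1,3-7) unfolding delta_hyperbolic_def by blast+
  then show ?thesis using assms(2,8-10) by linarith
qed

lemma gromov_boundary_cases:
  assumes "\<xi> \<in> gromov_boundary M d"
  obtains u where "u \<in> \<xi>" "converges_to_infinity M d u" "\<And>v. v \<in> \<xi> \<Longrightarrow> (u, v) \<in> seq_equiv_at_infinity M d"
proof -
  obtain u where u: "converges_to_infinity M d u" "\<xi> = seq_equiv_at_infinity M d `` {u}"
    using assms unfolding gromov_boundary_def quotient_def by blast
  have "filterlim (\<lambda>i. gromov_prod d p (u i) (u i)) at_top sequentially" if "p \<in> M" for p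
  proof -
    have "filterlim (\<lambda>(i, j). gromov_prod d p (u i) (u j)) at_top (sequentially \<times>\<^sub>F sequentially)"
      using u(1) that unfolding converges_to_infinity_def by blast
    moreover have "filterlim (\<lambda>i. (i, i)) (sequentially \<times>\<^sub>F sequentially) (sequentially :: nat filter)"
      by (intro filterlim_Pair filterlim_ident)
    ultimately show ?thesis by (drule_tac filterlim_compose) auto
  qed
  then have "(u, u) \<in> seq_equiv_at_infinity M d" using u(1) by (simp add: seq_equiv_at_infinity_def)
  then show ?thesis using u that by blast
qed

lemma gromov_boundary_in_space:
  assumes "\<xi> \<in> gromov_boundary M d" "v \<in> \<xi>"
  shows "v i \<in> M"
proof -
  obtain u where "(u, v) \<in> seq_equiv_at_infinity M d"
    using assms gromov_boundary_cases by metis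
  then show ?thesis by (auto simp: seq_equiv_at_infinity_def converges_to_infinity_def)
qed

lemma gromov_prod_bd_bd_geI:
  assumes "\<And>u v. u \<in> \<xi> \<Longrightarrow> v \<in> \<eta> \<Longrightarrow> \<forall>\<^sub>F i in sequentially. t \<le> gromov_prod d p (u i) (v i)"
  shows "ereal t \<le> gromov_prod_bd_bd d p \<xi> \<eta>"
  unfolding gromov_prod_bd_bd_def using assms by (intro INF_greatest Liminf_bounded) auto

lemma gromov_prod_bd_bd_gtD:
  assumes "ereal t < gromov_prod_bd_bd d p \<xi> \<eta>" "u \<in> \<xi>" "v \<in> \<eta>"
  shows "\<forall>\<^sub>F i in sequentially. t < gromov_prod d p (u i) (v i)"
proof -
  have "ereal t < (INF y\<in>\<eta>. liminf (\<lambda>i. ereal (gromov_prod d p (u i) (y i))))"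
    using assms(1,2) unfolding gromov_prod_bd_bd_def by (rule less_INF_D)
  then have "ereal t < liminf (\<lambda>i. ereal (gromov_prod d p (u i) (v i)))"
    using assms(3) by (rule less_INF_D)
  then show ?thesis using less_LiminfD by force
qed

lemma gromov_prod_pt_bd_gtD:
  assumes "ereal t < gromov_prod_pt_bd d p x \<xi>" "v \<in> \<xi>"
  shows "\<forall>\<^sub>F i in sequentially. t < gromov_prod d p x (v i)"
proof -
  have "ereal t < liminf (\<lambda>i. ereal (gromov_prod d p x (v i)))"
    using assms unfolding gromov_prod_pt_bd_def by (rule less_INF_D)
  then show ?thesis using less_LiminfD by force
qed

lemma neg_powr_le:
  assumes "1 < a" "ereal t \<le> e"
  shows "neg_powr a e \<le> a powr (- t)"
  using assms by (cases e) (auto simp: neg_powr_def)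

text \<open>The relation \<open>shadow x \<xi>\<close> is \<open>(x|\<xi>) \<ge> |xp| - D\<close>, spelled out for the sequences in \<open>\<xi>\<close>. If \<open>x\<close>
  and \<open>y\<close> have shadows \<open>\<xi>\<close> and \<open>\<eta>\<close>, two applications of hyperbolicity along \<open>\<xi>, x, y, \<eta>\<close> bound
  \<open>(\<xi>|\<eta>)\<close> from below by \<open>(x|y)\<close>, and along \<open>x, \<xi>, \<eta>, y\<close> they bound \<open>(x|y)\<close> from below by
  \<open>min(|xp|, (\<xi>|\<eta>), |yp|)\<close>, up to constants; the visual metric turns both into statements
  on \<open>\<rho>\<close>. Every point has a shadow because the space is visual, after a change of base point.
  Geodesics give points of any height over \<open>\<xi>\<close>: take the point at distance \<open>t\<close> from \<open>p\<close> on
  a geodesic to a far member of a sequence representing \<open>\<xi>\<close>. This replaces a point on a geodesic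
  ray, which may not exist when the space is not proper.\<close>

lemma visual_boundary_shadow:
  assumes M: "Metric_space X d" and geo: "geodesic_metric X d" and hyp: "gromov_hyperbolic X d"
    and vis: "visual_space X d" and vm: "visual_metric X d \<rho>"
  shows "\<exists>p a A shadow. boundary_shadow X d (gromov_boundary X d) \<rho> p a A shadow"
proof -
  interpret Metric_space X d by fact
  let ?E = "gromov_boundary X d"
  obtain \<delta> where \<delta>: "0 \<le> \<delta>" "delta_hyperbolic \<delta> X d" using hyp unfolding gromov_hyperbolic_def by blast
  obtain p a c1 c2 where p: "p \<in> X" and a: "1 < a" and c: "0 < c1" "0 < c2"
    and lower: "\<And>\<xi> \<eta>. \<xi> \<in> ?E \<Longrightarrow> \<eta> \<in> ?E \<Longrightarrow> c1 * neg_powr a (gromov_prod_bd_bd d p \<xi> \<eta>) \<le> \<rho> \<xi> \<eta>"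
    and upper: "\<And>\<xi> \<eta>. \<xi> \<in> ?E \<Longrightarrow> \<eta> \<in> ?E \<Longrightarrow> \<rho> \<xi> \<eta> \<le> c2 * neg_powr a (gromov_prod_bd_bd d p \<xi> \<eta>)"
    using vm unfolding visual_metric_def by metis
  have ME: "Metric_space ?E \<rho>" using vm unfolding visual_metric_def by blast
  interpret E: Metric_space ?E \<rho> by fact
  obtain x0 D0 where x0: "x0 \<in> X" and D0: "0 < D0"
    and vis: "\<And>x. x \<in> X \<Longrightarrow> \<exists>\<xi>\<in>?E. ereal (d x x0) \<le> gromov_prod_pt_bd d x0 x \<xi> + ereal D0"
    using vis unfolding visual_space_def by blast
  define D where "D = 2 * \<delta> + D0 + 2 * d p x0 + 1"
  have D: "2 * \<delta> \<le> D" "0 \<le> D" "D0 + 2 * d p x0 + 1 \<le> D" using \<delta>(1) D0 by (auto simp: D_def)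
  define shadow where "shadow x \<xi> \<longleftrightarrow>
      (\<forall>v\<in>\<xi>. \<forall>\<^sub>F i in sequentially. d x p - D \<le> gromov_prod d p x (v i))" for x \<xi>
  define A where "A = a powr (2 * \<delta> + D) * (1 + a / c1 + c2)"
  have pw: "1 \<le> a powr (2 * \<delta> + D)" using a \<delta>(1) D(2) by (intro ge_one_powr_ge_zero) auto
  have A: "1 \<le> A" "a powr (2 * \<delta> + D) \<le> A" "a powr (2 * \<delta> + D) * (a / c1) \<le> A"
     "a powr (2 * \<delta> + D) * c2 \<le> A"
  proof -
    let ?P = "a powr (2 * \<delta> + D)"
    have "A = ?P + ?P * (a / c1) + ?P * c2" by (simp add: A_def algebra_simps)
    moreover have "0 \<le> ?P * (a / c1)" "0 \<le> ?P * c2" using a c by auto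
    ultimately show "1 \<le> A" "?P \<le> A" "?P * (a / c1) \<le> A" "?P * c2 \<le> A" using pw by linarith+
  qed
  have pt_eq: "gromov_prod d p x y = gromov_prod d p y x" for x y by (rule gromov_prod_commute[OF M])
  have "boundary_shadow X d ?E \<rho> p a A shadow"
  proof (unfold_locales)
    show "p \<in> X" "1 < a" "1 \<le> A" by fact+
  next
    fix x y \<xi> \<eta>
    assume x: "x \<in> X" and y: "y \<in> X" and \<xi>: "\<xi> \<in> ?E" and \<eta>: "\<eta> \<in> ?E" and sh: "shadow x \<xi>" "shadow y \<eta>"
    have xy: "gromov_prod d p x y \<le> d x p" "gromov_prod d p x y \<le> d y p"
      using gromov_prod_le_dist[OF M p x y] gromov_prod_le_dist[OF M p y x] pt_eq[of x y] by auto
    have "ereal (gromov_prod d p x y - D - 2 * \<delta>) \<le> gromov_prod_bd_bd d p \<xi> \<eta>"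
    proof (rule gromov_prod_bd_bd_geI)
      fix u v assume uv: "u \<in> \<xi>" "v \<in> \<eta>"
      have "\<forall>\<^sub>F i in sequentially. d x p - D \<le> gromov_prod d p x (u i)"
        "\<forall>\<^sub>F i in sequentially. d y p - D \<le> gromov_prod d p y (v i)"
        using sh uv by (auto simp: shadow_def)
      then show "\<forall>\<^sub>F i in sequentially. gromov_prod d p x y - D - 2 * \<delta> \<le> gromov_prod d p (u i) (v i)"
      proof eventually_elim
        case (elim i)
        have "min (d x p - D) (min (gromov_prod d p x y) (d y p - D)) - 2 * \<delta> \<le> gromov_prod d p (u i) (v i)"
          by (rule delta_hyperbolic_three[OF \<delta>(2,1) p, of _ x y])
            (use elim x y gromov_boundary_in_space[OF \<xi> uv(1)] gromov_boundary_in_space[OF \<eta> uv(2)]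
              pt_eq[of "u i" x] in auto)
        then show ?case using xy D(2) by linarith
      qed
    qed
    then have "neg_powr a (gromov_prod_bd_bd d p \<xi> \<eta>) \<le> a powr (- (gromov_prod d p x y - D - 2 * \<delta>))"
      by (rule neg_powr_le[OF a])
    then have "\<rho> \<xi> \<eta> \<le> c2 * a powr (- (gromov_prod d p x y - D - 2 * \<delta>))"
      using upper[OF \<xi> \<eta>] c(2) by (meson less_imp_le mult_left_mono order_trans)
    also have "\<dots> = a powr (2 * \<delta> + D) * c2 * a powr (- gromov_prod d p x y)"
      by (simp add: powr_add[symmetric] algebra_simps)
    also have "\<dots> \<le> A * a powr (- gromov_prod d p x y)" using A(4) by (intro mult_right_mono) auto
    finally show "\<rho> \<xi> \<eta> \<le> A * a powr (- gromov_prod d p x y)" .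
  next
    fix x y \<xi> \<eta>
    assume x: "x \<in> X" and y: "y \<in> X" and \<xi>: "\<xi> \<in> ?E" and \<eta>: "\<eta> \<in> ?E" and sh: "shadow x \<xi>" "shadow y \<eta>"
    let ?m = "max (a powr (- d x p)) (max (a powr (- d y p)) (\<rho> \<xi> \<eta>))"
    let ?e = "gromov_prod_bd_bd d p \<xi> \<eta>"
    obtain u where u: "u \<in> \<xi>" by (rule gromov_boundary_cases[OF \<xi>])
    obtain v where v: "v \<in> \<eta>" by (rule gromov_boundary_cases[OF \<eta>])
    have e0: "0 \<le> ?e"
    proof -
      have "ereal 0 \<le> ?e"
        by (rule gromov_prod_bd_bd_geI)
          (use gromov_prod_nonneg[OF M p] gromov_boundary_in_space[OF \<xi>] gromov_boundary_in_space[OF \<eta>]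
            in simp)
      then show ?thesis by (simp add: zero_ereal_def)
    qed
    \<comment> \<open>A number strictly below \<open>(\<xi>|\<eta>)\<close> eventually bounds the products along \<open>u\<close> and \<open>v\<close>. A finite
      \<open>(\<xi>|\<eta>)\<close> is undercut by \<open>1\<close>, at the cost of a factor \<open>a\<close>; for an infinite one \<open>|xp|\<close> is large enough.\<close>
    obtain t where t: "ereal t < ?e" "a powr (- t) \<le> max (a powr (- d x p)) (a / c1 * \<rho> \<xi> \<eta>)"
    proof (cases ?e)
      case (real e)
      have "a powr (- (e - 1)) = a * a powr (- e)" using a by (simp add: powr_diff powr_minus field_simps)
      also have "\<dots> = a / c1 * (c1 * neg_powr a ?e)" using real c by (simp add: neg_powr_def)
      also have "\<dots> \<le> a / c1 * \<rho> \<xi> \<eta>" using lower[OF \<xi> \<eta>] a c by (intro mult_left_mono) auto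
      finally show ?thesis using real by (intro that[of "e - 1"]) auto
    next
      case PInf
      then show ?thesis by (intro that[of "d x p"]) auto
    qed (use e0 in auto)
    have "\<forall>\<^sub>F i in sequentially. t \<le> gromov_prod d p (u i) (v i)"
      using gromov_prod_bd_bd_gtD[OF t(1) u v] by eventually_elim simp
    moreover have "\<forall>\<^sub>F i in sequentially. d x p - D \<le> gromov_prod d p x (u i)"
        "\<forall>\<^sub>F i in sequentially. d y p - D \<le> gromov_prod d p y (v i)"
        using sh u v by (auto simp: shadow_def)
    ultimately have "\<forall>\<^sub>F i in sequentially.
       min (d x p - D) (min t (d y p - D)) - 2 * \<delta> \<le> gromov_prod d p x y"
    proof eventually_elim
      case (elim i)
      show ?case
        by (rule delta_hyperbolic_three[OF \<delta>(2,1) p, of _ "u i" "v i"])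
          (use elim x y gromov_boundary_in_space[OF \<xi> u] gromov_boundary_in_space[OF \<eta> v]
            pt_eq[of "v i" y] in auto)
    qed
    then have "min (d x p - D) (min t (d y p - D)) - 2 * \<delta> \<le> gromov_prod d p x y" by simp
    then consider "d x p - (2 * \<delta> + D) \<le> gromov_prod d p x y" | "d y p - (2 * \<delta> + D) \<le> gromov_prod d p x y"
      | "t - 2 * \<delta> \<le> gromov_prod d p x y" by linarith
    then show "a powr (- gromov_prod d p x y) \<le> A * ?m"
    proof cases
      case 1
      have "a powr (- gromov_prod d p x y) \<le> a powr ((2 * \<delta> + D) + - d x p)"
        using 1 a by (intro powr_mono) auto
      also have "\<dots> \<le> A * ?m" by (subst powr_add, intro mult_mono) (use A in auto)
      finally show ?thesis .
    next
      case 2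
      have "a powr (- gromov_prod d p x y) \<le> a powr ((2 * \<delta> + D) + - d y p)"
        using 2 a by (intro powr_mono) auto
      also have "\<dots> \<le> A * ?m" by (subst powr_add, intro mult_mono) (use A in auto)
      finally show ?thesis .
    next
      case 3
      let ?P = "a powr (2 * \<delta> + D)"
      have "a powr (- gromov_prod d p x y) \<le> a powr ((2 * \<delta> + D) + - t)"
        using 3 a D(2) by (intro powr_mono) auto
      also have "\<dots> \<le> ?P * max (a powr (- d x p)) (a / c1 * \<rho> \<xi> \<eta>)"
        by (subst powr_add, intro mult_left_mono) (use t(2) in auto)
      also have "\<dots> = max (?P * a powr (- d x p)) (?P * (a / c1) * \<rho> \<xi> \<eta>)"
        by (simp add: max_mult_distrib_left mult.assoc)
      also have "\<dots> \<le> A * ?m"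
        using A by (intro max.boundedI mult_mono) auto
      finally show ?thesis .
    qed
  next
    fix x assume x: "x \<in> X"
    obtain \<xi> where \<xi>: "\<xi> \<in> ?E" "ereal (d x x0) \<le> gromov_prod_pt_bd d x0 x \<xi> + ereal D0"
      using vis[OF x] by blast
    have lt: "ereal (d x x0 - D0 - 1) < gromov_prod_pt_bd d x0 x \<xi>"
      using \<xi>(2) by (cases "gromov_prod_pt_bd d x0 x \<xi>") auto
    have "shadow x \<xi>" unfolding shadow_def
    proof
      fix v assume v: "v \<in> \<xi>"
      from gromov_prod_pt_bd_gtD[OF lt v]
      show "\<forall>\<^sub>F i in sequentially. d x p - D \<le> gromov_prod d p x (v i)"
      proof eventually_elim
        case (elim i)
        have vi: "v i \<in> X" by (rule gromov_boundary_in_space[OF \<xi>(1) v])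
        show ?case
          using elim triangle[OF x x0 p] triangle[OF x p x0] triangle[OF vi p x0] D(3)
            commute[of x0 p] unfolding gromov_prod_def by (simp add: field_simps)
      qed
    qed
    then show "\<exists>\<xi>\<in>?E. shadow x \<xi>" using \<xi>(1) by blast
  next
    fix \<xi> and t :: real
    assume \<xi>: "\<xi> \<in> ?E" and t: "0 \<le> t"
    obtain u where u: "u \<in> \<xi>" "converges_to_infinity X d u"
      and eqv: "\<And>v. v \<in> \<xi> \<Longrightarrow> (u, v) \<in> seq_equiv_at_infinity X d"
      using gromov_boundary_cases[OF \<xi>] by blast
    have uX: "u i \<in> X" for i by (rule gromov_boundary_in_space[OF \<xi> u(1)])
    have "filterlim (\<lambda>(i, j). gromov_prod d p (u i) (u j)) at_top (sequentially \<times>\<^sub>F sequentially)"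
      using u(2) p unfolding converges_to_infinity_def by blast
    then have "\<forall>\<^sub>F (i, j) in sequentially \<times>\<^sub>F sequentially. t \<le> gromov_prod d p (u i) (u j)"
      unfolding filterlim_at_top by (auto simp: case_prod_unfold)
    then obtain N where N: "\<And>i j. N \<le> i \<Longrightarrow> N \<le> j \<Longrightarrow> t \<le> gromov_prod d p (u i) (u j)"
      unfolding eventually_prod_sequentially by auto
    have ty: "t \<le> d p (u N)"
      using N[of N N] gromov_prod_le_dist[OF M p uX uX, of N N] commute[of p "u N"] by simp
    obtain \<gamma> where \<gamma>: "\<gamma> ` {0..d p (u N)} \<subseteq> X" "\<gamma> 0 = p" "\<gamma> (d p (u N)) = u N"
      "\<And>s t. s \<in> {0..d p (u N)} \<Longrightarrow> t \<in> {0..d p (u N)} \<Longrightarrow> d (\<gamma> s) (\<gamma> t) = \<bar>s - t\<bar>"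
      using geo p uX[of N] unfolding geodesic_metric_def by meson
    define x where "x = \<gamma> t"
    have x: "x \<in> X" using \<gamma>(1) t ty by (auto simp: x_def)
    have xp: "d x p = t" using \<gamma>(4)[of t 0] t ty \<gamma>(2) by (simp add: x_def)
    have xu: "d x (u N) = d p (u N) - t" using \<gamma>(4)[of t "d p (u N)"] t ty \<gamma>(3) by (simp add: x_def)
    have gxu: "t \<le> gromov_prod d p x (u N)"
      using xp xu commute[of p "u N"] by (simp add: gromov_prod_def)
    have "shadow x \<xi>" unfolding shadow_def
    proof
      fix v assume v: "v \<in> \<xi>"
      have "filterlim (\<lambda>i. gromov_prod d p (u i) (v i)) at_top sequentially"
        using eqv[OF v] p unfolding seq_equiv_at_infinity_def by blast
      then have "\<forall>\<^sub>F i in sequentially. t \<le> gromov_prod d p (u i) (v i)"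
        unfolding filterlim_at_top by blast
      then show "\<forall>\<^sub>F i in sequentially. d x p - D \<le> gromov_prod d p x (v i)"
        using eventually_ge_at_top[of N]
      proof eventually_elim
        case (elim i)
        have "min t (min t t) - 2 * \<delta> \<le> gromov_prod d p x (v i)"
          by (rule delta_hyperbolic_three[OF \<delta>(2,1) p, of _ "u N" "u i"])
            (use elim x uX gromov_boundary_in_space[OF \<xi> v] gxu N[of N i] in auto)
        then show ?case using xp D(1) by simp
      qed
    qed
    then show "\<exists>x\<in>X. d x p = t \<and> shadow x \<xi>" using x xp by blast
  qed
  then show ?thesis by blast
qed

section \<open>Comparison of the dimensions\<close>

lemma Metric_space_linf_dist:
  assumes "Metric_space A d1" "Metric_space B d2"
  shows "Metric_space (A \<times> B) (linf_dist d1 d2)"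
proof -
  interpret A: Metric_space A d1 by fact
  interpret B: Metric_space B d2 by fact
  show ?thesis
  proof
    fix x y z
    show "0 \<le> linf_dist d1 d2 x y" by (simp add: linf_dist_def le_max_iff_disj)
    show "linf_dist d1 d2 x y = linf_dist d1 d2 y x"
      by (simp add: linf_dist_def A.commute B.commute)
    assume xy: "x \<in> A \<times> B" "y \<in> A \<times> B"
    have "linf_dist d1 d2 x y = 0 \<longleftrightarrow> d1 (fst x) (fst y) = 0 \<and> d2 (snd x) (snd y) = 0"
      using A.nonneg[of "fst x" "fst y"] B.nonneg[of "snd x" "snd y"] unfolding linf_dist_def by linarith
    then show "linf_dist d1 d2 x y = 0 \<longleftrightarrow> x = y"
      using xy by (auto simp: prod_eq_iff)
    assume "z \<in> A \<times> B"
    then show "linf_dist d1 d2 x z \<le> linf_dist d1 d2 x y + linf_dist d1 d2 y z"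
      using xy A.triangle[of "fst x" "fst y" "fst z"] B.triangle[of "snd x" "snd y" "snd z"]
      by (auto simp: linf_dist_def)
  qed
qed

lemma asdim_le_l_asdim:
  "asdim X d \<le> l_asdim X d"
  unfolding asdim_def l_asdim_def
proof (rule Inf_superset_mono, safe)
  fix m and C :: real
  assume C: "1 < C" "\<forall>\<^sub>F D in at_top. \<exists>\<U>. LMn_covering X d D (C * D) (m + 1) \<U>"
  show "\<exists>m'. enat m = enat m' \<and> (\<forall>D>0. \<exists>\<U>. open_covering X d \<U> \<and>
      cover_multiplicity \<U> \<le> enat (m' + 1) \<and> mesh d \<U> < \<infinity> \<and> ennreal D \<le> lebesgue_number X d \<U>)"
  proof (intro exI[of _ m] conjI refl allI impI)
    fix D0 :: real assume "0 < D0"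
    have "\<forall>\<^sub>F D in at_top. D0 \<le> D \<and> (\<exists>\<U>. LMn_covering X d D (C * D) (m + 1) \<U>)"
      using C(2) eventually_ge_at_top[of D0] by eventually_elim blast
    then obtain D \<U> where D: "D0 \<le> D" and U: "LMn_covering X d D (C * D) (m + 1) \<U>"
      unfolding eventually_at_top_linorder by blast
    have "mesh d \<U> < \<infinity>" using U unfolding LMn_covering_def by (auto intro: le_less_trans)
    moreover have "ennreal D0 \<le> lebesgue_number X d \<U>"
      using U D unfolding LMn_covering_def by (meson ennreal_leI order_trans)
    ultimately show "\<exists>\<U>. open_covering X d \<U> \<and> cover_multiplicity \<U> \<le> enat (m + 1) \<and>
        mesh d \<U> < \<infinity> \<and> ennreal D0 \<le> lebesgue_number X d \<U>"
      using U colored_cover_multiplicity[of "m + 1" \<U>] unfolding LMn_covering_def by blast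
  qed
qed

context boundary_shadow
begin

lemma Metric_space_cyl: "Metric_space cyl cyl_dist"
proof (rule Metric_space_linf_dist[OF E.Metric_space_axioms])
  show "Metric_space {0..1::real} dist"
    by unfold_locales (auto simp: dist_commute intro: dist_triangle)
qed

lemma l_dim_cylinder_le_asdim: "l_dim cyl cyl_dist \<le> asdim X d"
  unfolding asdim_def l_dim_def
proof (rule Inf_superset_mono, safe)
  fix m
  assume as: "\<forall>D>0. \<exists>\<U>. open_covering X d \<U> \<and> cover_multiplicity \<U> \<le> enat (m + 1) \<and>
      mesh d \<U> < \<infinity> \<and> ennreal D \<le> lebesgue_number X d \<U>"
  have "\<exists>K\<ge>0. chain_colorable X d (m + 1) r K" if "0 < r" for r
  proof -
    have "0 < real (m + 1 + 3) * r" using that by simp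
    then obtain \<U> where U: "cover_multiplicity \<U> \<le> enat (m + 1)" "mesh d \<U> < \<infinity>"
      "ennreal (real (m + 1 + 3) * r) \<le> lebesgue_number X d \<U>" using as by blast
    have "mesh d \<U> \<le> ennreal (enn2real (mesh d \<U>))" using U(2) by (simp add: less_top)
    from multiplicity_imp_chain_colorable[OF X.Metric_space_axioms U(1) this _ that U(3)]
    show ?thesis by (meson enn2real_nonneg)
  qed
  from cylinder_chain_colorable[OF this] obtain C \<tau>0 where C: "1 \<le> C" "0 < \<tau>0"
    "\<And>\<tau>. 0 < \<tau> \<Longrightarrow> \<tau> \<le> \<tau>0 \<Longrightarrow> chain_colorable cyl cyl_dist (m + 1) \<tau> (C * \<tau>)" by blast
  let ?\<delta> = "1 / (2 * (C + 1))"
  have cov: "\<exists>\<U>. LMn_covering cyl cyl_dist (?\<delta> * \<tau>) \<tau> (m + 1) \<U>" if "0 < \<tau>" "\<tau> < (C + 1) * \<tau>0" for \<tau>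
  proof -
    have \<tau>: "0 < \<tau> / (C + 1)" "\<tau> / (C + 1) \<le> \<tau>0" using that C by (auto simp: field_simps)
    have "0 \<le> C * (\<tau> / (C + 1))" using that C by simp
    from chain_colorable_imp_LMn_covering[OF Metric_space_cyl C(3)[OF \<tau>] this \<tau>(1)]
    obtain \<U> where "LMn_covering cyl cyl_dist (\<tau> / (C + 1) / 2) (C * (\<tau> / (C + 1)) + \<tau> / (C + 1)) (m + 1) \<U>"
      by blast
    moreover have "\<tau> / (C + 1) / 2 = ?\<delta> * \<tau>" using C(1) by (simp add: field_simps)
    moreover have "C * (\<tau> / (C + 1)) + \<tau> / (C + 1) = \<tau>" using C(1) by (simp add: add_divide_distrib[symmetric] field_simps)
    ultimately show ?thesis by metis
  qed
  have pos: "0 < (C + 1) * \<tau>0" using C by simp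
  have "\<forall>\<^sub>F \<tau> in at_right 0. \<exists>\<U>. LMn_covering cyl cyl_dist (?\<delta> * \<tau>) \<tau> (m + 1) \<U>"
    unfolding eventually_at_right_field
    by (intro exI[of _ "(C + 1) * \<tau>0"] conjI allI impI pos cov)
  moreover have "?\<delta> \<in> {0<..<1}" using C(1) by simp
  ultimately show "\<exists>m'. enat m = enat m' \<and> (\<exists>\<delta>\<in>{0<..<1}.
      \<forall>\<^sub>F \<tau> in at_right 0. \<exists>\<U>. LMn_covering cyl cyl_dist (\<delta> * \<tau>) \<tau> (m' + 1) \<U>)"
    by (intro exI[of _ m] conjI refl bexI)
qed

text \<open>The cylinder is bounded, by \<open>A\<close>, so a coloring that is linearly controlled at small scales is
  so at all scales: at the remaining ones a single color works. This serves the slabs near the base point.\<close>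

lemma l_asdim_le_l_dim_cylinder: "l_asdim X d \<le> l_dim cyl cyl_dist"
  unfolding l_asdim_def l_dim_def
proof (rule Inf_superset_mono, safe)
  fix m and \<delta> :: real
  assume \<delta>: "\<delta> \<in> {0<..<1}"
    and ev: "\<forall>\<^sub>F \<tau> in at_right 0. \<exists>\<U>. LMn_covering cyl cyl_dist (\<delta> * \<tau>) \<tau> (m + 1) \<U>"
  have "\<exists>b>0. \<forall>\<tau>>0. \<tau> < b \<longrightarrow> (\<exists>\<U>. LMn_covering cyl cyl_dist (\<delta> * \<tau>) \<tau> (m + 1) \<U>)"
    using ev by (simp only: eventually_at_right_field)
  then obtain b where b: "0 < b"
    and cov: "\<forall>\<tau>>0. \<tau> < b \<longrightarrow> (\<exists>\<U>. LMn_covering cyl cyl_dist (\<delta> * \<tau>) \<tau> (m + 1) \<U>)"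
    by (elim exE conjE)
  define C where "C = max (2 / \<delta>) (2 * A / (\<delta> * b))"
  have "1 \<le> 2 / \<delta>" using \<delta> by simp
  then have C: "1 \<le> C" "2 / \<delta> \<le> C" "2 * A / (\<delta> * b) \<le> C" by (auto simp: C_def)
  have col: "chain_colorable cyl cyl_dist (m + 1) \<sigma> (C * \<sigma>)" if \<sigma>: "0 < \<sigma>" for \<sigma>
  proof (cases "2 / \<delta> * \<sigma> < b")
    case True
    have pos: "0 < 2 / \<delta> * \<sigma>" using \<sigma> \<delta> by simp
    obtain \<U> where U: "LMn_covering cyl cyl_dist (\<delta> * (2 / \<delta> * \<sigma>)) (2 / \<delta> * \<sigma>) (m + 1) \<U>"
      using cov[rule_format, OF pos True] by (elim exE)
    have "\<sigma> < \<delta> * (2 / \<delta> * \<sigma>)" using \<sigma> \<delta> by simp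
    from LMn_covering_imp_chain_colorable[OF Metric_space_cyl U less_imp_le[OF pos] \<sigma> this]
    have "chain_colorable cyl cyl_dist (m + 1) \<sigma> (2 / \<delta> * \<sigma>)" .
    moreover have "2 / \<delta> * \<sigma> \<le> C * \<sigma>" using C(2) \<sigma> by (intro mult_right_mono) auto
    ultimately show ?thesis by (rule chain_colorable_mono)
  next
    case False
    have "A = 2 * A / (\<delta> * b) * (\<delta> * b / 2)" using \<delta> b by simp
    also have "\<dots> \<le> C * (\<delta> * b / 2)" using C(3) \<delta> b by (intro mult_right_mono) auto
    also have "\<dots> \<le> C * \<sigma>"
      using False C(1) \<delta> by (intro mult_left_mono) (auto simp: field_simps)
    finally have "A \<le> C * \<sigma>" .
    then have "cyl_dist u v \<le> C * \<sigma>" if "u \<in> cyl" "v \<in> cyl" for u v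
      using that shadow_dist_le_A[of "fst u" "fst v"] A_ge_1 by (auto simp: linf_dist_def dist_real_def)
    then show ?thesis by (intro chain_colorable_bounded) auto
  qed
  define W where "W = 4 * A * (2 * C + 2)"
  have W: "0 < W" using A_ge_1 C by (simp add: W_def)
  define C' where "C' = 2 * (16 * C + 25)"
  have cov': "\<exists>\<U>. LMn_covering X d D (C' * D) (m + 1) \<U>" if D: "max 1 (log a W) \<le> D" for D
  proof -
    have "W \<le> a powr (2 * D / 2)" using D W a_gt_1 by (simp add: log_le_iff)
    then have "chain_colorable X d (m + 1) (2 * D) ((16 * C + 24) * (2 * D))"
      using space_chain_colorable[OF C(1) _ _ col, of "2 * D"] D by (simp add: W_def)
    from chain_colorable_imp_LMn_covering[OF X.Metric_space_axioms this]
    obtain \<U> where "LMn_covering X d (2 * D / 2) ((16 * C + 24) * (2 * D) + 2 * D) (m + 1) \<U>"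
      using C(1) D by auto
    moreover have "(16 * C + 24) * (2 * D) + 2 * D = C' * D" by (simp add: C'_def algebra_simps)
    ultimately show ?thesis by auto
  qed
  have "1 < C'" using C(1) by (simp add: C'_def)
  moreover have "\<forall>\<^sub>F D in at_top. \<exists>\<U>. LMn_covering X d D (C' * D) (m + 1) \<U>"
    using eventually_ge_at_top[of "max 1 (log a W)"] by eventually_elim (rule cov')
  ultimately show "\<exists>n. enat m = enat n \<and> (\<exists>C>1. \<forall>\<^sub>F D in at_top.
      \<exists>\<U>. LMn_covering X d D (C * D) (n + 1) \<U>)" by blast
qed

end

theorem corollary1p6:
  fixes X :: "'a set" and d :: "'a \<Rightarrow> 'a \<Rightarrow> real"
    and \<rho> :: "(nat \<Rightarrow> 'a) set \<Rightarrow> (nat \<Rightarrow> 'a) set \<Rightarrow> real"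
  assumes "Metric_space X d"
    and "geodesic_metric X d"
    and "gromov_hyperbolic X d"
    and "visual_space X d"
    and "visual_metric X d \<rho>"
  shows "l_asdim X d = asdim X d \<and>
    asdim X d = l_dim (gromov_boundary X d \<times> {0..1::real}) (linf_dist \<rho> dist)"
proof -
  obtain p a A shadow where "boundary_shadow X d (gromov_boundary X d) \<rho> p a A shadow"
    using visual_boundary_shadow[OF assms] by blast
  then interpret boundary_shadow X d "gromov_boundary X d" \<rho> p a A shadow .
  have "asdim X d \<le> l_asdim X d" by (rule asdim_le_l_asdim)
  moreover have "l_asdim X d \<le> l_dim cyl cyl_dist" by (rule l_asdim_le_l_dim_cylinder)
  moreover have "l_dim cyl cyl_dist \<le> asdim X d" by (rule l_dim_cylinder_le_asdim)
  ultimately have "asdim X d = l_asdim X d" "l_dim cyl cyl_dist = asdim X d"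
    by (meson antisym order_trans)+
  then show ?thesis by simp
qed

end
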